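(* Let $p\geq 2$, let $d_1,\ldots,d_p$ be positive integers, and let $D=d_1d_2\cdots d_p-d_1-d_2-\cdots-d_p+p-1$. Then every decomposable matrix $W=\sum_{A\subseteq\{1,\ldots,p\}}T_A(X_A)$, with each $X_A\in M_{d_1}\otimes\cdots\otimes M_{d_p}$ positive semidefinite, has at most $D$ strictly negative eigenvalues (counted with multiplicity). Furthermore, this number is attained using only $p-1$ single-system partial transpositions: there exist positive semidefinite $X_1,\ldots,X_{p-1}\in M_{d_1}\otimes\cdots\otimes M_{d_p}$ such that $T_1(X_1)+\cdots+T_{p-1}(X_{p-1})$ has exactly $D$ strictly negative eigenvalues.
   Context: $M_d$ is the set of $d\times d$ complex matrices. For $A\subseteq\{1,\ldots,p\}$, $T_A$ is the partial transpose on the subsystems in $A$: the linear map on $M_{d_1}\otimes\cdots\otimes M_{d_p}$ acting as the transpose on the tensor factors indexed by $A$ and as the identity on the others. $T_j=T_{\{j\}}$ is the partial transpose on the $j$-th subsystem. (A multipartite decomposable entanglement witness is a matrix that is not positive semidefinite and is a sum of partial transposes, over various combinations of subsystems, of positive semidefinite matrices.) *)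

theory Defs
  imports
    "HOL-Computational_Algebra.Polynomial"
    "Jordan_Normal_Form.Char_Poly"
    "Jordan_Normal_Form.Schur_Decomposition"
begin

definition positive_semidefinite :: "nat \<Rightarrow> complex mat \<Rightarrow> bool" where
  "positive_semidefinite n X \<longleftrightarrow>
     X \<in> carrier_mat n n \<and> mat_adjoint X = X \<and>
     (\<forall>v \<in> carrier_vec n. 0 \<le> (X *\<^sub>v v) \<bullet>c v)"

text \<open>Eigenvalues are counted with algebraic multiplicity; all matrices concerned are Hermitian,
  for which it agrees with the geometric one.\<close>

definition num_neg_eigenvalues :: "complex mat \<Rightarrow> nat" where
  "num_neg_eigenvalues W = size {# x \<in># proots (char_poly W). x \<in> \<real> \<and> Re x < 0 #}"

definition mat_sum :: "nat \<Rightarrow> ('i \<Rightarrow> complex mat) \<Rightarrow> 'i set \<Rightarrow> complex mat" where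
  "mat_sum n = finsum (module_mat TYPE(complex) n n)"

lemma index_mat_sum:
  assumes "finite I" "\<And>a. a \<in> I \<Longrightarrow> F a \<in> carrier_mat n n"
  shows "mat_sum n F I \<in> carrier_mat n n \<and>
         (\<forall>i<n. \<forall>j<n. mat_sum n F I $$ (i, j) = (\<Sum>a\<in>I. F a $$ (i, j)))"
proof -
  interpret M: abelian_group "module_mat TYPE(complex) n n"
    by (rule abelian_group_mat)
  show ?thesis
    using assms
  proof (induction I rule: finite_induct)
    case empty
    show ?case by (simp add: mat_sum_def module_mat_simps)
  next
    case (insert a I)
    have "mat_sum n F (insert a I) = F a + mat_sum n F I"
      unfolding mat_sum_def using insert.hyps insert.prems
      by (subst M.finsum_insert) (auto simp: module_mat_simps)
    then show ?case using insert by auto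
  qed
qed

text \<open>The tensor product of the matrix algebras of sizes \<open>d 1, \<dots>, d p\<close> is identified with the square
  matrices of size \<open>tensor_dim p d\<close> through the Kronecker product: a row or column index below
  \<open>tensor_dim p d\<close> is the mixed-radix encoding, most significant digit first, of a multi-index
  whose \<open>k\<close>-th component \<open>digit p d i k\<close> (for \<open>k\<close> from \<open>1\<close> to \<open>p\<close>) lies in \<open>{..<d k}\<close>.\<close>

definition tensor_dim :: "nat \<Rightarrow> (nat \<Rightarrow> nat) \<Rightarrow> nat" where
  "tensor_dim p d = (\<Prod>k=1..p. d k)"

definition stride :: "nat \<Rightarrow> (nat \<Rightarrow> nat) \<Rightarrow> nat \<Rightarrow> nat" where
  "stride p d k = (\<Prod>l\<in>{k<..p}. d l)"

definition digit :: "nat \<Rightarrow> (nat \<Rightarrow> nat) \<Rightarrow> nat \<Rightarrow> nat \<Rightarrow> nat" where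
  "digit p d i k = (i div stride p d k) mod d k"

definition encode :: "nat \<Rightarrow> (nat \<Rightarrow> nat) \<Rightarrow> (nat \<Rightarrow> nat) \<Rightarrow> nat" where
  "encode p d f = (\<Sum>k=1..p. f k * stride p d k)"

definition kronecker :: "nat \<Rightarrow> (nat \<Rightarrow> nat) \<Rightarrow> (nat \<Rightarrow> complex mat) \<Rightarrow> complex mat" where
  "kronecker p d Y = mat (tensor_dim p d) (tensor_dim p d)
     (\<lambda>(i, j). \<Prod>k=1..p. Y k $$ (digit p d i k, digit p d j k))"

text \<open>Transposing the factors in \<open>A\<close> exchanges the \<open>A\<close>-components of the row and column
  multi-indices. Together with linearity, \<open>partial_transpose_kronecker\<close> below characterises this
  map.\<close>

definition partial_transpose ::
    "nat \<Rightarrow> (nat \<Rightarrow> nat) \<Rightarrow> nat set \<Rightarrow> complex mat \<Rightarrow> complex mat" where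
  "partial_transpose p d A X = mat (tensor_dim p d) (tensor_dim p d)
     (\<lambda>(i, j). X $$
        (encode p d (\<lambda>k. if k \<in> A then digit p d j k else digit p d i k),
         encode p d (\<lambda>k. if k \<in> A then digit p d i k else digit p d j k)))"

definition decomposable :: "nat \<Rightarrow> (nat \<Rightarrow> nat) \<Rightarrow> complex mat \<Rightarrow> bool" where
  "decomposable p d W \<longleftrightarrow>
     (\<exists>X. (\<forall>A \<in> Pow {1..p}. positive_semidefinite (tensor_dim p d) (X A)) \<and>
          W = mat_sum (tensor_dim p d) (\<lambda>A. partial_transpose p d A (X A)) (Pow {1..p}))"

lemma stride_Suc: "k \<le> p \<Longrightarrow> stride (Suc p) d k = stride p d k * d (Suc p)"
proof -
  assume "k \<le> p"
  then have "{k<..Suc p} = insert (Suc p) {k<..p}" by auto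
  then show ?thesis by (simp add: stride_def mult.commute)
qed

lemma stride_self [simp]: "stride p d p = 1"
  by (simp add: stride_def)

lemma encode_Suc: "encode (Suc p) d f = encode p d f * d (Suc p) + f (Suc p)"
  by (simp add: encode_def stride_Suc sum_distrib_right mult.assoc)

lemma digit_Suc: "k \<le> p \<Longrightarrow> digit (Suc p) d i k = digit p d (i div d (Suc p)) k"
  by (simp add: digit_def stride_Suc div_mult2_eq mult.commute)

lemma digit_top: "digit p d i p = i mod d p"
  by (simp add: digit_def)

lemma encode_less:
  "(\<And>k. k \<in> {1..p} \<Longrightarrow> f k < d k) \<Longrightarrow> encode p d f < tensor_dim p d"
proof (induction p)
  case 0
  show ?case by (simp add: encode_def tensor_dim_def)
next
  case (Suc p)
  have "encode p d f < tensor_dim p d" "f (Suc p) < d (Suc p)" using Suc by auto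
  then have "encode p d f * d (Suc p) + f (Suc p) < Suc (encode p d f) * d (Suc p)"
    by simp
  also have "\<dots> \<le> tensor_dim p d * d (Suc p)"
    using \<open>encode p d f < tensor_dim p d\<close> by (intro mult_right_mono) auto
  finally show ?case by (simp add: encode_Suc tensor_dim_def)
qed

lemma digit_encode:
  "(\<And>k. k \<in> {1..p} \<Longrightarrow> f k < d k) \<Longrightarrow> k \<in> {1..p} \<Longrightarrow> digit p d (encode p d f) k = f k"
proof (induction p)
  case (Suc p)
  have f: "f (Suc p) < d (Suc p)" using Suc.prems(1) by simp
  then have div: "encode (Suc p) d f div d (Suc p) = encode p d f"
    by (simp add: encode_Suc)
  show ?case
  proof (cases "k = Suc p")
    case True
    then show ?thesis using f by (simp add: digit_top encode_Suc)
  next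
    case False
    then have k: "k \<in> {1..p}" using Suc.prems(2) by auto
    have "digit (Suc p) d (encode (Suc p) d f) k = digit p d (encode p d f) k"
      using k by (simp add: digit_Suc div)
    then show ?thesis using Suc.IH Suc.prems(1) k by simp
  qed
qed simp

lemma encode_digit: "i < tensor_dim p d \<Longrightarrow> encode p d (digit p d i) = i"
proof (induction p arbitrary: i)
  case 0
  then show ?case by (simp add: encode_def tensor_dim_def)
next
  case (Suc p)
  have "i div d (Suc p) < tensor_dim p d"
    using Suc.prems by (simp add: tensor_dim_def less_mult_imp_div_less)
  then have "encode p d (digit p d (i div d (Suc p))) = i div d (Suc p)"
    by (rule Suc.IH)
  moreover have "encode p d (digit (Suc p) d i) = encode p d (digit p d (i div d (Suc p)))"
    by (simp add: encode_def digit_Suc)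
  ultimately show ?case by (simp add: encode_Suc digit_top)
qed

lemma partial_transpose_kronecker:
  assumes d: "\<And>k. k \<in> {1..p} \<Longrightarrow> 0 < d k"
    and Y: "\<And>k. k \<in> {1..p} \<Longrightarrow> Y k \<in> carrier_mat (d k) (d k)"
  shows "partial_transpose p d A (kronecker p d Y) =
         kronecker p d (\<lambda>k. if k \<in> A then transpose_mat (Y k) else Y k)"
proof (rule eq_matI)
  fix i j
  assume "i < dim_row (kronecker p d (\<lambda>k. if k \<in> A then transpose_mat (Y k) else Y k))"
    and "j < dim_col (kronecker p d (\<lambda>k. if k \<in> A then transpose_mat (Y k) else Y k))"
  then have ij: "i < tensor_dim p d" "j < tensor_dim p d"
    by (simp_all add: kronecker_def)
  have dig: "digit p d i k < d k" if "k \<in> {1..p}" for i k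
    using d[OF that] by (simp add: digit_def)
  define f where "f = (\<lambda>k. if k \<in> A then digit p d j k else digit p d i k)"
  define g where "g = (\<lambda>k. if k \<in> A then digit p d i k else digit p d j k)"
  have fg: "f k < d k" "g k < d k" if "k \<in> {1..p}" for k
    using dig[OF that] by (auto simp: f_def g_def)
  have enc: "encode p d f < tensor_dim p d" "encode p d g < tensor_dim p d"
    using fg by (auto intro: encode_less)
  have "partial_transpose p d A (kronecker p d Y) $$ (i, j) =
        kronecker p d Y $$ (encode p d f, encode p d g)"
    using ij by (simp add: partial_transpose_def f_def g_def)
  also have "\<dots> = (\<Prod>k=1..p. Y k $$ (f k, g k))"
  proof -
    have "digit p d (encode p d f) k = f k" "digit p d (encode p d g) k = g k"
      if "k \<in> {1..p}" for k
      using fg that by (auto intro!: digit_encode)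
    then show ?thesis using enc by (simp add: kronecker_def)
  qed
  also have "\<dots> = (\<Prod>k=1..p. (if k \<in> A then transpose_mat (Y k) else Y k)
                       $$ (digit p d i k, digit p d j k))"
  proof (rule prod.cong)
    fix k assume k: "k \<in> {1..p}"
    show "Y k $$ (f k, g k) = (if k \<in> A then transpose_mat (Y k) else Y k)
            $$ (digit p d i k, digit p d j k)"
      using Y[OF k] dig[OF k] by (auto simp: f_def g_def)
  qed simp
  also have "\<dots> = kronecker p d (\<lambda>k. if k \<in> A then transpose_mat (Y k) else Y k) $$ (i, j)"
    using ij by (simp add: kronecker_def)
  finally show "partial_transpose p d A (kronecker p d Y) $$ (i, j) =
    kronecker p d (\<lambda>k. if k \<in> A then transpose_mat (Y k) else Y k) $$ (i, j)" .
qed (simp_all add: partial_transpose_def kronecker_def)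

end

theory Submission
  imports Defs "HOL-Library.Function_Algebras" "HOL-Analysis.Continuum_Not_Denumerable"
begin

text \<open>The form of a decomposable \<open>W\<close> is nonnegative on product vectors, since there a partial
  transposition only conjugates some of the factors. If \<open>W\<close> had more than \<open>D\<close> negative eigenvalues, at
  most \<open>n = \<Sum>(d\<^sub>k - 1)\<close> linear forms would cut out its negative eigenspace. The Segre variety has
  dimension \<open>n\<close>, so they have a common zero on it, a contradiction. This dimension count is proved
  directly: without a common zero, the Nullstellensatz would make the homogeneous coordinate ring a
  finite module over a polynomial ring in the \<open>n\<close> forms, and its degree-\<open>t\<close> parts would grow like
  \<open>t\<^bsup>n - 1\<^esup>\<close> instead of \<open>t\<^sup>n\<close>.

  For sharpness, grade indices by their digit sum \<open>s\<close> and let \<open>S\<close>, of dimension \<open>D\<close>, be the space of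
  vectors whose entries sum to zero in every degree. Swapping one digit between two indices of degree
  \<open>s\<close> moves them to degrees \<open>s - \<delta>\<close> and \<open>s + \<delta>\<close>, so a partially transposed rank-one matrix supported
  there couples the original two indices. Coupling all pairs of degree \<open>s\<close> with the same weight gives
  minus that weight times the squared norm on \<open>S\<close>, and log-convex weights make the diagonal cost in
  the degrees \<open>s \<plusminus> \<delta>\<close> negligible.\<close>

section \<open>Linear dependence and underdetermined systems\<close>

lemma (in vector_space) exists_dependency:
  assumes "finite C" "finite B" "card B < card C" "h ` C \<subseteq> span B"
  shows "\<exists>l. (\<exists>c\<in>C. l c \<noteq> 0) \<and> (\<Sum>c\<in>C. l c *s h c) = 0"
proof (cases "inj_on h C")
  case True
  have "dependent (h ` C)"
    using independent_span_bound[OF assms(2) _ assms(4)] assms(3) card_image[OF True] by force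
  then obtain u v where u: "v \<in> h ` C" "u v \<noteq> 0" "(\<Sum>v\<in>h ` C. u v *s v) = 0"
    using dependent_finite[of "h ` C"] assms(1) by auto
  have "(\<Sum>c\<in>C. u (h c) *s h c) = 0"
    using u(3) by (simp add: sum.reindex[OF True])
  with u(1,2) show ?thesis by (intro exI[of _ "u \<circ> h"]) auto
next
  case False
  then obtain a b where ab: "a \<in> C" "b \<in> C" "a \<noteq> b" "h a = h b"
    by (auto simp: inj_on_def)
  \<comment> \<open>The dependency is one of an indexed family, so a repeated value already gives
    one, with coefficients 1 and -1.\<close>
  define l where "l = (\<lambda>c. if c = a then 1 else if c = b then - 1 else (0::'a))"
  have "(\<Sum>c\<in>C. l c *s h c) = (\<Sum>c\<in>{a, b}. l c *s h c)"
    using ab assms(1) by (intro sum.mono_neutral_right) (auto simp: l_def)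
  also have "\<dots> = 0" using ab by (simp add: l_def)
  finally show ?thesis using ab(1) by (intro exI[of _ l]) (auto simp: l_def)
qed

lemma vector_space_fun: "vector_space (\<lambda>(c::'a::field) f i. c * f i)"
  by unfold_locales (auto simp: fun_eq_iff algebra_simps)

text \<open>The columns of the system lie in the span of at most \<open>card Q\<close> unit
  functions, so they are dependent; the coefficients of a dependency form a solution.\<close>

lemma exists_nontrivial_solution:
  fixes w :: "'b \<Rightarrow> 'c \<Rightarrow> 'a::field"
  assumes "finite Q" "finite C" "card Q < card C"
  shows "\<exists>v. (\<exists>i\<in>C. v i \<noteq> 0) \<and> (\<forall>q\<in>Q. (\<Sum>i\<in>C. v i * w q i) = 0)"
proof -
  interpret vector_space "\<lambda>(c::'a) (f::'b \<Rightarrow> 'a) i. c * f i" by (rule vector_space_fun)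
  define e :: "'b \<Rightarrow> 'b \<Rightarrow> 'a" where "e = (\<lambda>q q'. if q' = q then 1 else 0)"
  define h where "h = (\<lambda>i q. if q \<in> Q then w q i else 0)"
  have sum_apply: "(\<Sum>x\<in>X. F x) q = (\<Sum>x\<in>X. F x q)" for X and F :: "'d \<Rightarrow> 'b \<Rightarrow> 'a" and q
    by (induction X rule: infinite_finite_induct) auto
  have "h i \<in> span (e ` Q)" for i
  proof -
    have "h i = (\<Sum>q\<in>Q. (\<lambda>q'. w q i * e q q'))"
      using assms(1) by (auto simp: fun_eq_iff h_def e_def sum_apply if_distrib sum.delta cong: if_cong)
    also have "\<dots> \<in> span (e ` Q)"
      by (intro span_sum span_scale span_base) auto
    finally show ?thesis .
  qed
  moreover have "card (e ` Q) < card C"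
    using assms card_image_le[OF assms(1), of e] by linarith
  ultimately obtain l where l: "\<exists>c\<in>C. l c \<noteq> 0" "(\<Sum>c\<in>C. (\<lambda>q. l c * h c q)) = 0"
    using exists_dependency[of C "e ` Q" h] assms by auto
  have "(\<Sum>i\<in>C. l i * w q i) = 0" if "q \<in> Q" for q
    using fun_cong[OF l(2), of q] that by (simp add: sum_apply h_def)
  with l(1) show ?thesis by blast
qed

section \<open>Spectral theorem for Hermitian matrices\<close>

text \<open>A square matrix of size \<open>N\<close> acts on functions; only the values at indices below \<open>N\<close> matter.\<close>

definition mat_op :: "nat \<Rightarrow> (nat \<Rightarrow> nat \<Rightarrow> complex) \<Rightarrow> (nat \<Rightarrow> complex) \<Rightarrow> nat \<Rightarrow> complex" where
  "mat_op N w v i = (\<Sum>j<N. w i j * v j)"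

lemma mat_op_linear:
  "mat_op N w (\<lambda>k. a * u k + b * v k) i = a * mat_op N w u i + b * mat_op N w v i"
  by (simp add: mat_op_def sum_distrib_left sum.distrib algebra_simps)

text \<open>Some nonzero polynomial \<open>q\<close> satisfies \<open>q(W) y = 0\<close>; applying its linear factors to \<open>y\<close> one
  after the other yields an eigenvector just before the result vanishes.\<close>

lemma eigenvector_of_annihilator:
  assumes "q \<noteq> 0" "\<And>k. k < N \<Longrightarrow> (\<Sum>i\<le>degree q. coeff q i * (mat_op N w ^^ i) y k) = 0"
    and "\<exists>k<N. y k \<noteq> 0" "S y"
    and S: "\<And>v r. S v \<Longrightarrow> S (\<lambda>k. mat_op N w v k - r * v k)"
  shows "\<exists>z r. S z \<and> (\<exists>k<N. z k \<noteq> 0) \<and> (\<forall>k<N. mat_op N w z k = r * z k)"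
  using assms(1-4)
proof (induction "degree q" arbitrary: q y)
  case 0
  then obtain k where "k < N" "y k \<noteq> 0" by blast
  with 0(3)[of k] 0(1) have "coeff q 0 = 0" by auto
  with 0 show ?case by (metis leading_coeff_0_iff)
next
  case (Suc n)
  then obtain r where r: "poly q r = 0"
    using fundamental_theorem_of_algebra[of q] by (auto simp: constant_degree)
  then obtain q' where q: "q = [:- r, 1:] * q'" by (auto simp: poly_eq_0_iff_dvd)
  with Suc.prems(1) have q'0: "q' \<noteq> 0" by auto
  have deg: "degree q = Suc (degree q')"
    unfolding q using q'0 by (subst degree_mult_eq) auto
  define y' where "y' = (\<lambda>k. mat_op N w y k - r * y k)"
  show ?case
  proof (cases "\<exists>k<N. y' k \<noteq> 0")
    case False
    then show ?thesis using Suc.prems by (intro exI[of _ y] exI[of _ r]) (auto simp: y'_def)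
  next
    case True
    \<comment> \<open>\<open>y'\<close> is the matrix minus \<open>r\<close> applied to
      \<open>y\<close>, which commutes with iteration; so the sum for \<open>q'\<close> at
      \<open>y'\<close> is the sum for \<open>q\<close> at \<open>y\<close>.\<close>
    have pow: "(mat_op N w ^^ i) y' k = (mat_op N w ^^ Suc i) y k - r * (mat_op N w ^^ i) y k" for i k
    proof (induction i arbitrary: k)
      case 0 show ?case by (simp add: y'_def)
    next
      case (Suc i)
      have "(mat_op N w ^^ Suc i) y' k
          = mat_op N w (\<lambda>k. 1 * (mat_op N w ^^ Suc i) y k + (- r) * (mat_op N w ^^ i) y k) k"
        by (simp add: Suc.IH[abs_def])
      then show ?case unfolding mat_op_linear by simp
    qed
    have "(\<Sum>i\<le>degree q'. coeff q' i * (mat_op N w ^^ i) y' k) = 0" if "k < N" for k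
    proof -
      let ?a = "\<lambda>i. (mat_op N w ^^ i) y k"
      have c: "coeff q i = (case i of 0 \<Rightarrow> 0 | Suc j \<Rightarrow> coeff q' j) - r * coeff q' i" for i
        unfolding q by (simp add: coeff_pCons split: nat.splits)
      have "0 = (\<Sum>i\<le>degree q. coeff q i * ?a i)" using Suc.prems(2)[OF that] by simp
      also have "\<dots> = (\<Sum>i\<le>Suc (degree q'). (case i of 0 \<Rightarrow> 0 | Suc j \<Rightarrow> coeff q' j) * ?a i)
          - (\<Sum>i\<le>Suc (degree q'). r * coeff q' i * ?a i)"
        unfolding deg c by (simp add: sum_subtractf algebra_simps)
      also have "(\<Sum>i\<le>Suc (degree q'). (case i of 0 \<Rightarrow> 0 | Suc j \<Rightarrow> coeff q' j) * ?a i)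
          = (\<Sum>i\<le>degree q'. coeff q' i * ?a (Suc i))"
        by (subst sum.atMost_Suc_shift) simp
      also have "(\<Sum>i\<le>Suc (degree q'). r * coeff q' i * ?a i) = (\<Sum>i\<le>degree q'. r * coeff q' i * ?a i)"
        by (simp add: coeff_eq_0)
      finally show ?thesis unfolding pow
        by (simp add: sum_subtractf algebra_simps)
    qed
    then show ?thesis
      using Suc.hyps(1)[of q' y'] Suc.hyps(2) deg q'0 True S[OF Suc.prems(4), of r]
      unfolding y'_def[symmetric] by auto
  qed
qed

text \<open>The \<open>N + 1\<close> iterates of \<open>y\<close> have only \<open>N\<close>
  relevant coordinates; a dependency among them is the annihilating polynomial. The predicate
  \<open>S\<close> plays the part of an invariant subspace. It will be orthogonality to the
  eigenvectors already found, so no restricted operator has to be constructed.\<close>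

lemma exists_eigenvector:
  assumes "\<exists>k<N. y k \<noteq> 0" "S y"
    and S: "\<And>v r. S v \<Longrightarrow> S (\<lambda>k. mat_op N w v k - r * v k)"
  shows "\<exists>z r. S z \<and> (\<exists>k<N. z k \<noteq> 0) \<and> (\<forall>k<N. mat_op N w z k = r * z k)"
proof -
  obtain c where c: "\<exists>i\<in>{..N}. c i \<noteq> 0"
    "\<forall>k\<in>{..<N}. (\<Sum>i\<in>{..N}. c i * (mat_op N w ^^ i) y k) = 0"
    using exists_nontrivial_solution[of "{..<N}" "{..N}" "\<lambda>k i. (mat_op N w ^^ i) y k"] by auto
  define q where "q = (\<Sum>i\<le>N. monom (c i) i)"
  have cq: "coeff q i = (if i \<le> N then c i else 0)" for i
    by (simp add: q_def coeff_sum)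
  then have deg: "degree q \<le> N" by (simp add: degree_le)
  have "q \<noteq> 0" using c(1) cq by (metis atMost_iff coeff_0)
  moreover have "(\<Sum>i\<le>degree q. coeff q i * (mat_op N w ^^ i) y k) = 0" if "k < N" for k
  proof -
    have "(\<Sum>i\<le>degree q. coeff q i * (mat_op N w ^^ i) y k)
        = (\<Sum>i\<le>N. coeff q i * (mat_op N w ^^ i) y k)"
      using deg by (intro sum.mono_neutral_left) (auto simp: coeff_eq_0)
    then show ?thesis using c(2) that by (simp add: cq)
  qed
  ultimately show ?thesis using eigenvector_of_annihilator[of q N w y S] assms by blast
qed

text \<open>The orthogonal complement of fewer than \<open>N\<close> eigenvectors is nonzero and, by
  self-adjointness (\<open>adj\<close>), invariant, so it contains another eigenvector.\<close>

lemma spectral_orthonormal_family: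
  assumes herm: "\<And>i j. i < N \<Longrightarrow> j < N \<Longrightarrow> w j i = cnj (w i j)" and "m \<le> N"
  shows "\<exists>u e. (\<forall>i<m. \<forall>j<m. (\<Sum>k<N. u i k * cnj (u j k)) = (if i = j then 1 else 0)) \<and>
           (\<forall>i<m. \<forall>k<N. mat_op N w (u i) k = complex_of_real (e i) * u i k)"
  using \<open>m \<le> N\<close>
proof (induction m)
  case 0 show ?case by simp
next
  case (Suc m)
  obtain u :: "nat \<Rightarrow> nat \<Rightarrow> complex" and e :: "nat \<Rightarrow> real"
    where u: "\<And>i j. i < m \<Longrightarrow> j < m \<Longrightarrow> (\<Sum>k<N. u i k * cnj (u j k)) = (if i = j then 1 else 0)"
    and e: "\<And>i k. i < m \<Longrightarrow> k < N \<Longrightarrow> mat_op N w (u i) k = complex_of_real (e i) * u i k"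
    using Suc.IH[OF Suc_leD[OF Suc.prems]] by blast
  have adj: "(\<Sum>k<N. mat_op N w v k * cnj (v' k)) = (\<Sum>k<N. v k * cnj (mat_op N w v' k))" for v v'
  proof -
    have "(\<Sum>k<N. mat_op N w v k * cnj (v' k)) = (\<Sum>k<N. \<Sum>j<N. w k j * v j * cnj (v' k))"
      by (simp add: mat_op_def sum_distrib_right)
    also have "\<dots> = (\<Sum>j<N. \<Sum>k<N. w k j * v j * cnj (v' k))" by (rule sum.swap)
    also have "\<dots> = (\<Sum>j<N. \<Sum>k<N. v j * cnj (w j k * v' k))"
    proof (intro sum.cong refl)
      fix j k assume "j \<in> {..<N}" "k \<in> {..<N}"
      then have "w k j = cnj (w j k)" by (intro herm) auto
      then show "w k j * v j * cnj (v' k) = v j * cnj (w j k * v' k)" by (simp add: ac_simps)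
    qed
    also have "\<dots> = (\<Sum>k<N. v k * cnj (mat_op N w v' k))"
      by (simp add: mat_op_def sum_distrib_left)
    finally show ?thesis .
  qed
  define S where "S = (\<lambda>v. \<forall>i<m. (\<Sum>k<N. v k * cnj (u i k)) = 0)"
  obtain y where y: "\<exists>k<N. y k \<noteq> 0" "S y"
    using exists_nontrivial_solution[of "{..<m}" "{..<N}" "\<lambda>i k. cnj (u i k)"] Suc.prems
    by (auto simp: S_def)
  have "S (\<lambda>k. mat_op N w v k - r * v k)" if "S v" for v r
    unfolding S_def
  proof (intro allI impI)
    fix i assume i: "i < m"
    have "(\<Sum>k<N. (mat_op N w v k - r * v k) * cnj (u i k))
        = (\<Sum>k<N. v k * cnj (mat_op N w (u i) k)) - r * (\<Sum>k<N. v k * cnj (u i k))"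
      by (simp add: algebra_simps sum_subtractf sum_distrib_left adj[symmetric])
    also have "(\<Sum>k<N. v k * cnj (mat_op N w (u i) k)) = (\<Sum>k<N. e i * (v k * cnj (u i k)))"
      by (intro sum.cong) (auto simp: e[OF i])
    also have "\<dots> = e i * (\<Sum>k<N. v k * cnj (u i k))" by (simp add: sum_distrib_left)
    finally show "(\<Sum>k<N. (mat_op N w v k - r * v k) * cnj (u i k)) = 0"
      using that i by (simp add: S_def)
  qed
  then obtain z r where z: "S z" "\<exists>k<N. z k \<noteq> 0" "\<And>k. k < N \<Longrightarrow> mat_op N w z k = r * z k"
    using exists_eigenvector[of N y S w] y by blast
  define s where "s = (\<Sum>k<N. (cmod (z k))\<^sup>2)"
  have s: "s > 0" unfolding s_def
    using z(2) by (auto intro!: sum_pos2)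
  have zz: "(\<Sum>k<N. z k * cnj (z k)) = complex_of_real s"
    by (simp add: s_def complex_norm_square[symmetric] del: of_real_power)
  \<comment> \<open>Computing the inner product of the image of \<open>z\<close> with
    \<open>z\<close> in two ways shows that the eigenvalue is real.\<close>
  have "r * (\<Sum>k<N. z k * cnj (z k)) = (\<Sum>k<N. mat_op N w z k * cnj (z k))"
    by (simp add: z(3) sum_distrib_left algebra_simps)
  also have "\<dots> = cnj r * (\<Sum>k<N. z k * cnj (z k))"
    unfolding adj by (simp add: z(3) sum_distrib_left algebra_simps)
  finally have "r = cnj r" using s zz by simp
  then have r: "complex_of_real (Re r) = r" by (simp add: complex_eq_iff)
  define z' where "z' = (\<lambda>k. z k / complex_of_real (sqrt s))"
  have z'z': "(\<Sum>k<N. z' k * cnj (z' k)) = 1"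
  proof -
    have "(\<Sum>k<N. z' k * cnj (z' k)) = (\<Sum>k<N. z k * cnj (z k)) / complex_of_real (sqrt s * sqrt s)"
      by (simp add: z'_def sum_divide_distrib del: real_sqrt_mult_self)
    also have "\<dots> = 1" using s by (simp add: zz)
    finally show ?thesis .
  qed
  have z'u: "(\<Sum>k<N. z' k * cnj (u i k)) = 0" if "i < m" for i
  proof -
    have "(\<Sum>k<N. z' k * cnj (u i k)) = (\<Sum>k<N. z k * cnj (u i k)) / complex_of_real (sqrt s)"
      by (simp add: z'_def sum_divide_distrib)
    then show ?thesis using z(1) that by (simp add: S_def)
  qed
  have uz': "(\<Sum>k<N. u i k * cnj (z' k)) = 0" if "i < m" for i
    using arg_cong[OF z'u[OF that], of cnj] by (simp add: mult.commute)
  have ez': "mat_op N w z' k = complex_of_real (Re r) * z' k" if "k < N" for k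
  proof -
    have "mat_op N w z' k = mat_op N w (\<lambda>k. (1 / complex_of_real (sqrt s)) * z k + 0 * z k) k"
      by (simp add: z'_def)
    then show ?thesis unfolding mat_op_linear r using z(3)[OF that] by (simp add: z'_def)
  qed
  show ?case
    using u e z'z' z'u uz' ez'
    by (intro exI[of _ "u(m := z')"] exI[of _ "e(m := Re r)"]) (auto simp: less_Suc_eq)
qed

lemma spectral_theorem:
  assumes W: "W \<in> carrier_mat N N"
    and herm: "\<And>i j. i < N \<Longrightarrow> j < N \<Longrightarrow> W $$ (j, i) = cnj (W $$ (i, j))"
  shows "\<exists>u e. (\<forall>k<N. \<forall>l<N. W $$ (k, l) = (\<Sum>i<N. complex_of_real (e i) * u i k * cnj (u i l))) \<and>
           (\<forall>k<N. \<forall>l<N. (\<Sum>i<N. u i k * cnj (u i l)) = (if k = l then 1 else 0)) \<and>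
           num_neg_eigenvalues W = card {i. i < N \<and> e i < 0}"
proof -
  have "\<exists>u e. (\<forall>i<N. \<forall>j<N. (\<Sum>k<N. u i k * cnj (u j k)) = (if i = j then 1 else 0)) \<and>
           (\<forall>i<N. \<forall>k<N. mat_op N (\<lambda>i j. W $$ (i, j)) (u i) k = complex_of_real (e i) * u i k)"
    by (rule spectral_orthonormal_family) (use herm in blast)+
  then obtain u e where
    u: "\<And>i j. i < N \<Longrightarrow> j < N \<Longrightarrow> (\<Sum>k<N. u i k * cnj (u j k)) = (if i = j then 1 else 0)"
    and e: "\<And>i k. i < N \<Longrightarrow> k < N \<Longrightarrow>
        (\<Sum>j<N. W $$ (k, j) * u i j) = complex_of_real (e i) * u i k"
    unfolding mat_op_def by blast
  define U where "U = mat N N (\<lambda>(k, i). u i k)"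
  define V where "V = mat N N (\<lambda>(i, k). cnj (u i k))"
  define E where "E = mat N N (\<lambda>(i, j). if i = j then complex_of_real (e i) else 0)"
  have car: "U \<in> carrier_mat N N" "V \<in> carrier_mat N N" "E \<in> carrier_mat N N"
    by (auto simp: U_def V_def E_def)
  have VU: "V * U = 1\<^sub>m N"
  proof (rule eq_matI)
    fix i j assume "i < dim_row (1\<^sub>m N)" "j < dim_col (1\<^sub>m N)"
    then have ij: "i < N" "j < N" by auto
    have "(V * U) $$ (i, j) = (\<Sum>k<N. u j k * cnj (u i k))"
      using ij by (simp add: V_def U_def scalar_prod_def lessThan_atLeast0 mult.commute)
    then show "(V * U) $$ (i, j) = 1\<^sub>m N $$ (i, j)" using ij u[of j i] by auto
  qed (use car in auto)
  \<comment> \<open>A one-sided inverse of a square matrix is two-sided: this turns orthonormality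
    of the eigenvectors into the completeness relation of the conclusion.\<close>
  then have UV: "U * V = 1\<^sub>m N" using mat_mult_left_right_inverse[OF car(2,1)] by simp
  have WU: "W * U = U * E"
  proof (rule eq_matI)
    fix k i assume "k < dim_row (U * E)" "i < dim_col (U * E)"
    then have ij: "i < N" "k < N" using car by auto
    have "(W * U) $$ (k, i) = (\<Sum>j<N. W $$ (k, j) * u i j)"
      using ij W by (simp add: U_def scalar_prod_def lessThan_atLeast0)
    also have "\<dots> = complex_of_real (e i) * u i k" by (rule e) (use ij in auto)
    also have "\<dots> = (\<Sum>j<N. u j k * (if j = i then complex_of_real (e j) else 0))"
      using ij by (simp add: if_distrib sum.delta cong: if_cong)
    also have "\<dots> = (U * E) $$ (k, i)"
      using ij by (simp add: U_def E_def scalar_prod_def lessThan_atLeast0)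
    finally show "(W * U) $$ (k, i) = (U * E) $$ (k, i)" .
  qed (use car W in auto)
  have "W = W * (U * V)" using W UV by simp
  also have "\<dots> = W * U * V" using W car by (simp add: assoc_mult_mat[of _ N N _ N _ N])
  finally have WUEV: "W = U * E * V" using WU by simp
  have "similar_mat W E"
    unfolding similar_mat_def similar_mat_wit_def Let_def
    by (intro exI[of _ U] exI[of _ V]) (use car W UV VU WUEV in auto)
  then have "char_poly W = char_poly E" by (rule char_poly_similar)
  also have "\<dots> = (\<Prod>a\<leftarrow>diag_mat E. [:- a, 1:])"
    by (rule char_poly_upper_triangular[OF car(3)]) (auto simp: E_def)
  also have "diag_mat E = map (\<lambda>i. complex_of_real (e i)) [0..<N]"
    by (simp add: diag_mat_def E_def)
  finally have cp: "char_poly W = (\<Prod>a\<leftarrow>map (\<lambda>i. complex_of_real (e i)) [0..<N]. [:- a, 1:])" .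
  have pr: "proots (\<Prod>a\<leftarrow>as. [:- a, 1:]) = mset as" for as :: "complex list"
  proof (induction as)
    case (Cons a as)
    have nz: "(\<Prod>a\<leftarrow>as. [:- a, 1:]) \<noteq> 0" by (auto simp: prod_list_zero_iff)
    have "proots [:- a, 1:] = {#a#}" by simp
    then show ?case using Cons nz by (simp add: proots_mult del: mult_pCons_left)
  qed simp
  have "num_neg_eigenvalues W
      = size (filter_mset (\<lambda>x. x \<in> \<real> \<and> Re x < 0) (image_mset (\<lambda>i. complex_of_real (e i)) (mset [0..<N])))"
    unfolding num_neg_eigenvalues_def cp pr by simp
  also have "\<dots> = size (filter_mset (\<lambda>i. e i < 0) (mset [0..<N]))"
    by (simp add: filter_mset_image_mset)
  also have "\<dots> = card {i. i < N \<and> e i < 0}"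
    by (simp add: distinct_card[symmetric] flip: mset_filter size_mset)
  finally have nn: "num_neg_eigenvalues W = card {i. i < N \<and> e i < 0}" .
  have ent: "W $$ (k, l) = (\<Sum>i<N. complex_of_real (e i) * u i k * cnj (u i l))"
    if "k < N" "l < N" for k l
  proof -
    have UE: "(U * E) $$ (k, i) = complex_of_real (e i) * u i k" if "i < N" for i
    proof -
      have "(U * E) $$ (k, i) = (\<Sum>j<N. u j k * (if j = i then complex_of_real (e j) else 0))"
        using that \<open>k < N\<close> by (simp add: U_def E_def scalar_prod_def lessThan_atLeast0)
      then show ?thesis using that by (simp add: if_distrib sum.delta cong: if_cong)
    qed
    have "(M * V) $$ (k, l) = (\<Sum>i<N. M $$ (k, i) * V $$ (i, l))"
      if "M \<in> carrier_mat N N" for M :: "complex mat"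
      using that \<open>k < N\<close> \<open>l < N\<close> car by (simp add: scalar_prod_def lessThan_atLeast0)
    then have "W $$ (k, l) = (\<Sum>i<N. (U * E) $$ (k, i) * V $$ (i, l))"
      unfolding WUEV using car by (meson mult_carrier_mat)
    then show ?thesis using that by (simp add: UE V_def)
  qed
  have "(\<Sum>i<N. u i k * cnj (u i l)) = (if k = l then 1 else 0)" if "k < N" "l < N" for k l
  proof -
    have "(\<Sum>i<N. u i k * cnj (u i l)) = (U * V) $$ (k, l)"
      using that by (simp add: U_def V_def scalar_prod_def lessThan_atLeast0)
    then show ?thesis unfolding UV using that by simp
  qed
  with ent nn show ?thesis by blast
qed

section \<open>A Nullstellensatz over an uncountable field\<close>

locale complex_algebra = comm_ring_hom emb for emb :: "complex \<Rightarrow> 'a::comm_ring_1"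
begin

sublocale vector_space "\<lambda>c x. emb c * x"
  by unfold_locales (simp_all add: algebra_simps hom_distribs)

sublocale poly_hom: map_poly_comm_ring_hom emb ..

abbreviation aeval :: "complex poly \<Rightarrow> 'a \<Rightarrow> 'a" where
  "aeval q a \<equiv> poly (map_poly emb q) a"

definition subalgebra :: "'a set \<Rightarrow> bool" where
  "subalgebra R \<longleftrightarrow> subspace R \<and> 1 \<in> R \<and> (\<forall>x\<in>R. \<forall>y\<in>R. x * y \<in> R)"

definition ideal_of :: "'a set \<Rightarrow> 'a set \<Rightarrow> bool" where
  "ideal_of R J \<longleftrightarrow> J \<subseteq> R \<and> 0 \<in> J \<and> (\<forall>x\<in>J. \<forall>y\<in>J. x + y \<in> J) \<and> (\<forall>x\<in>R. \<forall>y\<in>J. x * y \<in> J)"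

lemma subalgebra_emb:
  assumes "subalgebra R" shows "emb c \<in> R"
  using assms subspace_scale[of R 1 c] by (simp add: subalgebra_def)

lemma subalgebra_power:
  assumes "subalgebra R" "x \<in> R" shows "x ^ n \<in> R"
  using assms by (induction n) (auto simp: subalgebra_def)

lemma subalgebra_diff:
  assumes "subalgebra R" "x \<in> R" "y \<in> R" shows "x - y \<in> R"
  using assms by (auto simp: subalgebra_def intro: subspace_diff)

lemma subalgebra_mult:
  assumes "subalgebra R" "x \<in> R" "y \<in> R" shows "x * y \<in> R"
  using assms by (auto simp: subalgebra_def)

lemma subalgebra_aeval:
  assumes R: "subalgebra R" and "a \<in> R" shows "aeval q a \<in> R"
proof (induction q)
  case 0 show ?case using R by (simp add: subalgebra_def subspace_0)
next
  case (pCons c q)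
  then show ?case using R assms(2)
    by (simp add: map_poly_pCons subalgebra_emb subalgebra_mult subalgebra_def subspace_add)
qed

lemma aeval_const: "aeval [:c:] a = emb c"
  by (cases "c = 0") (simp_all add: map_poly_pCons)

lemma aeval_linear_mult: "aeval ([:- c, 1:] * q) a = (a - emb c) * aeval q a"
  unfolding poly_hom.hom_mult poly_mult by (simp add: hom_uminus)

lemma ideal_of_mult:
  assumes "ideal_of R J" "x \<in> R" "y \<in> J" shows "x * y \<in> J"
  using assms by (auto simp: ideal_of_def)

lemma ideal_of_add:
  assumes "ideal_of R J" "x \<in> J" "y \<in> J" shows "x + y \<in> J"
  using assms by (auto simp: ideal_of_def)

lemma ideal_of_diff:
  assumes "subalgebra R" "ideal_of R J" "x \<in> J" "y \<in> J" shows "x - y \<in> J"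
proof -
  have "emb (- 1) * y \<in> J" using ideal_of_mult[OF assms(2) subalgebra_emb[OF assms(1)] assms(4)] .
  then show ?thesis using ideal_of_add[OF assms(2,3)] by (fastforce simp: hom_uminus)
qed

lemma ideal_of_sum:
  assumes "ideal_of R J" "\<And>i. i \<in> I \<Longrightarrow> f i \<in> J" shows "(\<Sum>i\<in>I. f i) \<in> J"
  using assms(2)
  by (induction I rule: infinite_finite_induct) (use assms(1) in \<open>auto simp: ideal_of_def\<close>)

text \<open>Zorn's lemma. By maximality, adjoining any \<open>g\<close> outside \<open>J\<close>
  captures a power of \<open>m\<close>; thus \<open>g\<close> becomes invertible modulo
  \<open>J\<close> once \<open>m\<close> is inverted.\<close>

lemma exists_maximal_avoiding_ideal:
  assumes R: "subalgebra R" and I: "ideal_of R I" and m: "m \<in> R" "\<And>s. m ^ s \<notin> I"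
  shows "\<exists>J. ideal_of R J \<and> I \<subseteq> J \<and> (\<forall>s. m ^ s \<notin> J) \<and>
           (\<forall>g\<in>R. g \<notin> J \<longrightarrow> (\<exists>s. \<exists>h\<in>R. m ^ s - g * h \<in> J))"
proof -
  define \<A> where "\<A> = {J. ideal_of R J \<and> I \<subseteq> J \<and> (\<forall>s. m ^ s \<notin> J)}"
  have "\<exists>M\<in>\<A>. \<forall>X\<in>\<A>. M \<subseteq> X \<longrightarrow> X = M"
  proof (rule subset_Zorn_nonempty)
    show "\<A> \<noteq> {}" using I m by (auto simp: \<A>_def)
  next
    fix C assume C: "C \<noteq> {}" "subset.chain \<A> C"
    then have CA: "C \<subseteq> \<A>" and lin: "\<And>X Y. X \<in> C \<Longrightarrow> Y \<in> C \<Longrightarrow> X \<subseteq> Y \<or> Y \<subseteq> X"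
      by (auto simp: subset_chain_def)
    have "x + y \<in> \<Union>C" if xy: "x \<in> \<Union>C" "y \<in> \<Union>C" for x y
    proof -
      obtain X Y where XY: "X \<in> C" "Y \<in> C" "x \<in> X" "y \<in> Y" using xy by blast
      then obtain Z where "Z \<in> C" "x \<in> Z" "y \<in> Z" using lin[of X Y] by blast
      moreover from this have "ideal_of R Z" using CA by (auto simp: \<A>_def)
      ultimately show ?thesis by (auto simp: ideal_of_def)
    qed
    moreover have "\<Union>C \<subseteq> R" using CA by (auto simp: \<A>_def ideal_of_def)
    moreover have "0 \<in> \<Union>C" "I \<subseteq> \<Union>C" using C(1) CA by (auto simp: \<A>_def ideal_of_def)
    moreover have "x * y \<in> \<Union>C" if xy: "x \<in> R" "y \<in> \<Union>C" for x y
    proof -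
      obtain Z where "Z \<in> C" "y \<in> Z" using xy by blast
      moreover from this have "ideal_of R Z" using CA by (auto simp: \<A>_def)
      ultimately have "x * y \<in> Z" using xy(1) by (auto simp: ideal_of_def)
      then show ?thesis using \<open>Z \<in> C\<close> by blast
    qed
    moreover have "m ^ s \<notin> \<Union>C" for s using CA by (auto simp: \<A>_def)
    ultimately show "\<Union>C \<in> \<A>" by (simp add: \<A>_def ideal_of_def)
  qed
  then obtain J where J: "J \<in> \<A>" and max: "\<And>X. X \<in> \<A> \<Longrightarrow> J \<subseteq> X \<Longrightarrow> X = J" by blast
  have id: "ideal_of R J" using J by (simp add: \<A>_def)
  have "\<exists>s. \<exists>h\<in>R. m ^ s - g * h \<in> J" if g: "g \<in> R" "g \<notin> J" for g
  proof (rule ccontr)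
    assume neg: "\<not> ?thesis"
    define X where "X = {j + g * h |j h. j \<in> J \<and> h \<in> R}"
    have zero: "0 \<in> J" "0 \<in> R" and one: "1 \<in> R"
      using id R by (auto simp: ideal_of_def subalgebra_def subspace_0)
    have "J \<subseteq> X" using zero by (force simp: X_def)
    moreover have "g = 0 + g * 1" by simp
    then have "g \<in> X" unfolding X_def using zero(1) one by blast
    moreover have "ideal_of R X"
      unfolding ideal_of_def
    proof (intro conjI ballI)
      show "X \<subseteq> R" using id R g
        by (auto simp: X_def ideal_of_def subalgebra_def intro!: subspace_add)
      show "0 \<in> X" using \<open>J \<subseteq> X\<close> zero by auto
    next
      fix x y assume "x \<in> X" "y \<in> X"
      then obtain j h j' h' where *: "x = j + g * h" "y = j' + g * h'" "j \<in> J" "j' \<in> J" "h \<in> R" "h' \<in> R"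
        by (auto simp: X_def)
      then have "x + y = (j + j') + g * (h + h')" "j + j' \<in> J" "h + h' \<in> R"
        using id R by (auto simp: algebra_simps ideal_of_def subalgebra_def intro: subspace_add)
      then show "x + y \<in> X" unfolding X_def by blast
    next
      fix x y assume "x \<in> R" "y \<in> X"
      then obtain j h where *: "y = j + g * h" "j \<in> J" "h \<in> R" by (auto simp: X_def)
      then have "x * y = x * j + g * (x * h)" "x * j \<in> J" "x * h \<in> R"
        using id R \<open>x \<in> R\<close> by (auto simp: algebra_simps ideal_of_def subalgebra_def)
      then show "x * y \<in> X" unfolding X_def by blast
    qed
    moreover have "m ^ s \<notin> X" for s
    proof
      assume "m ^ s \<in> X"
      then obtain j h where "m ^ s = j + g * h" "j \<in> J" "h \<in> R" by (auto simp: X_def)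
      then have "m ^ s - g * h \<in> J" "h \<in> R" by auto
      with neg show False by blast
    qed
    ultimately show False using max[of X] J g(2) by (auto simp: \<A>_def)
  qed
  with J show ?thesis by (auto simp: \<A>_def)
qed

text \<open>Over the complex numbers \<open>q\<close> splits into linear factors, and a prime ideal
  containing their product at \<open>a\<close> contains one of them; a nonzero scalar would put 1
  into \<open>J\<close>.\<close>

lemma root_in_prime_ideal:
  assumes R: "subalgebra R" and J: "ideal_of R J" and one: "1 \<notin> J"
    and prime: "\<And>x y. x \<in> R \<Longrightarrow> y \<in> R \<Longrightarrow> x * y \<in> J \<Longrightarrow> x \<in> J \<or> y \<in> J"
    and a: "a \<in> R" and q: "q \<noteq> 0" "aeval q a \<in> J"
  shows "\<exists>c. a - emb c \<in> J"
  using q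
proof (induction "degree q" arbitrary: q)
  case 0
  then obtain c where c: "q = [:c:]" "c \<noteq> 0" by (metis degree_eq_zeroE pCons_0_0)
  then have "emb c \<in> J" using 0 by simp
  then have "emb (inverse c) * emb c \<in> J"
    using ideal_of_mult[OF J subalgebra_emb[OF R]] by blast
  then have "1 \<in> J" using c(2) by (simp flip: hom_mult)
  with one show ?case by blast
next
  case (Suc n)
  then obtain r where "poly q r = 0"
    using fundamental_theorem_of_algebra[of q] by (auto simp: constant_degree)
  then obtain q' where q: "q = [:- r, 1:] * q'" by (auto simp: poly_eq_0_iff_dvd)
  with Suc.prems(1) have q'0: "q' \<noteq> 0" by auto
  have deg: "degree q = Suc (degree q')"
    unfolding q using q'0 by (subst degree_mult_eq) auto
  have "aeval q a = (a - emb r) * aeval q' a"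
    unfolding q by (rule aeval_linear_mult)
  then have "a - emb r \<in> J \<or> aeval q' a \<in> J"
    using prime[of "a - emb r" "aeval q' a"] Suc.prems(2)
      subalgebra_diff[OF R a subalgebra_emb[OF R]] subalgebra_aeval[OF R a] by simp
  then show ?case using Suc.hyps(1)[of q'] Suc.hyps(2) deg q'0 by auto
qed

text \<open>If no \<open>a - c\<close> were in the maximal ideal, the uncountably many inverses of the \<open>a - c\<close> in the
  localisation at \<open>m\<close> would be linearly dependent, and clearing denominators would give a nonzero
  polynomial in \<open>a\<close> lying in the ideal.\<close>

theorem nullstellensatz:
  assumes R: "subalgebra R" and I: "ideal_of R I" and m: "m \<in> R" "\<And>s. m ^ s \<notin> I"
    and B: "R \<subseteq> (\<Union>k::nat. span (B k))" "\<And>k. finite (B k)"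
  shows "\<exists>J \<phi>. ideal_of R J \<and> I \<subseteq> J \<and> 1 \<notin> J \<and> \<phi> m \<noteq> 0 \<and> (\<forall>a\<in>R. a - emb (\<phi> a) \<in> J)"
proof -
  obtain J where J: "ideal_of R J" "I \<subseteq> J" "\<And>s. m ^ s \<notin> J"
    and inv: "\<And>g. g \<in> R \<Longrightarrow> g \<notin> J \<Longrightarrow> \<exists>s. \<exists>h\<in>R. m ^ s - g * h \<in> J"
    using exists_maximal_avoiding_ideal[OF R I m] by blast
  have one: "1 \<notin> J" using J(3)[of 0] by simp
  have prime: "x \<in> J \<or> y \<in> J" if xy: "x \<in> R" "y \<in> R" "x * y \<in> J" for x y
  proof (rule ccontr)
    assume "\<not> ?thesis"
    then obtain s g t h where g: "m ^ s - x * g \<in> J" "g \<in> R" and h: "m ^ t - y * h \<in> J" "h \<in> R"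
      using inv xy by metis
    \<comment> \<open>Both \<open>x\<close> and \<open>y\<close> divide a power of \<open>m\<close>
      modulo \<open>J\<close>; if \<open>x * y\<close> were in \<open>J\<close>, the product of
      these powers would be as well.\<close>
    have "m ^ (s + t) = m ^ t * (m ^ s - x * g) + (x * g) * (m ^ t - y * h) + (g * h) * (x * y)"
      by (simp add: algebra_simps power_add)
    also have "\<dots> \<in> J"
      using ideal_of_mult[OF J(1) subalgebra_power[OF R m(1)] g(1)]
        ideal_of_mult[OF J(1) subalgebra_mult[OF R xy(1) g(2)] h(1)]
        ideal_of_mult[OF J(1) subalgebra_mult[OF R g(2) h(2)] xy(3)]
      by (intro ideal_of_add[OF J(1)])
    finally show False using J(3) by blast
  qed
  have "\<exists>c. a - emb c \<in> J" if a: "a \<in> R" for a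
  proof (rule ccontr)
    assume neg: "\<not> ?thesis"
    have "\<exists>s h k. m ^ s - (a - emb c) * h \<in> J \<and> h \<in> R \<and> h \<in> span (B k)" for c
    proof -
      have "a - emb c \<in> R" using subalgebra_diff[OF R a subalgebra_emb[OF R]] .
      then obtain s h where "m ^ s - (a - emb c) * h \<in> J" "h \<in> R" using inv neg by blast
      then show ?thesis using B(1) by blast
    qed
    then obtain s h k where h: "\<And>c. m ^ s c - (a - emb c) * h c \<in> J" "\<And>c. h c \<in> R"
      "\<And>c. h c \<in> span (B (k c))" by metis
    \<comment> \<open>There are uncountably many \<open>c\<close> but only countably many pairs of
      an exponent and a finite-dimensional span, so infinitely many \<open>c\<close> share a
      pair.\<close>
    have "\<exists>t. infinite {c. (s c, k c) = t}"
    proof (rule ccontr)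
      assume "\<not> ?thesis"
      then have "countable (\<Union>t. {c. (s c, k c) = t})"
        by (intro countable_UN) (auto intro: countable_finite)
      moreover have "(\<Union>t. {c. (s c, k c) = t}) = UNIV" by auto
      ultimately show False using uncountable_UNIV_complex by simp
    qed
    then obtain t l where "infinite {c. (s c, k c) = (t, l)}" by auto
    then obtain C where C: "C \<subseteq> {c. (s c, k c) = (t, l)}" "finite C" "card C = Suc (card (B l))"
      using infinite_arbitrarily_large by blast
    have "\<exists>u. (\<exists>c\<in>C. u c \<noteq> 0) \<and> (\<Sum>c\<in>C. emb (u c) * h c) = 0"
      using C h(3) B(2) by (intro exists_dependency[of C "B l"]) force+
    then obtain u c0 where l: "c0 \<in> C" "u c0 \<noteq> 0" "(\<Sum>c\<in>C. emb (u c) * h c) = 0" by blast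
    define P where "P = (\<lambda>c. \<Prod>c'\<in>C - {c}. [:- c', 1:])"
    \<comment> \<open>The numerator of the sum of \<open>u c / (a - c)\<close> over the common
      denominator. It is nonzero since at \<open>c0\<close> only the term of \<open>c0\<close>
      survives.\<close>
    define q where "q = (\<Sum>c\<in>C. [:u c:] * P c)"
    have "poly q c0 = (\<Sum>c\<in>C. u c * (\<Prod>c'\<in>C - {c}. c0 - c'))"
      by (simp add: q_def P_def poly_sum poly_prod)
    also have "\<dots> = (\<Sum>c\<in>{c0}. u c * (\<Prod>c'\<in>C - {c}. c0 - c'))"
      using C(2) l(1) by (intro sum.mono_neutral_right) (auto simp: prod_zero_iff)
    also have "\<dots> \<noteq> 0" using l(2) C(2) by (simp add: prod_zero_iff)
    finally have q0: "q \<noteq> 0" by auto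
    have P: "aeval (P c) a * (a - emb c) = aeval (\<Prod>c'\<in>C. [:- c', 1:]) a" if "c \<in> C" for c
    proof -
      have "(\<Prod>c'\<in>C. [:- c', 1:]) = [:- c, 1:] * P c"
        unfolding P_def using C(2) that by (rule prod.remove)
      then show ?thesis using aeval_linear_mult[of c "P c" a] by (simp only: mult.commute)
    qed
    have "aeval q a * m ^ t = (\<Sum>c\<in>C. emb (u c) * aeval (P c) a * m ^ t)"
    proof -
      have "aeval ([:u c:] * P c) a = emb (u c) * aeval (P c) a" for c
        unfolding poly_hom.hom_mult poly_mult aeval_const ..
      then show ?thesis unfolding q_def poly_hom.hom_sum poly_sum sum_distrib_right by simp
    qed
    \<comment> \<open>Replacing \<open>m ^ t\<close> by \<open>(a - emb c) * h c\<close> leaves an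
      error in \<open>J\<close>; the main part is the full product times the vanishing combination
      of the \<open>h c\<close>.\<close>
    also have "\<dots> = (\<Sum>c\<in>C. emb (u c) * aeval (P c) a * (m ^ t - (a - emb c) * h c))
        + aeval (\<Prod>c'\<in>C. [:- c', 1:]) a * (\<Sum>c\<in>C. emb (u c) * h c)"
      unfolding sum_distrib_left sum.distrib[symmetric]
      by (intro sum.cong refl) (simp add: P[symmetric] algebra_simps)
    also have "\<dots> \<in> J"
      unfolding l(3) using C(1) h(1)
      by (auto intro!: ideal_of_sum[OF J(1)] ideal_of_mult[OF J(1)] subalgebra_mult[OF R]
          subalgebra_emb[OF R] subalgebra_aeval[OF R a])
    finally have "aeval q a \<in> J"
      using prime[OF subalgebra_aeval[OF R a] subalgebra_power[OF R m(1)]] J(3) by blast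
    then show False using root_in_prime_ideal[OF R J(1) one prime a q0] neg by blast
  qed
  then obtain \<phi> where \<phi>: "\<And>a. a \<in> R \<Longrightarrow> a - emb (\<phi> a) \<in> J" by metis
  have "\<phi> m \<noteq> 0" using \<phi>[OF m(1)] J(3)[of 1] by auto
  with J \<phi> one show ?thesis by blast
qed

text \<open>Turns congruences of scalars modulo a proper ideal into equalities. With it,
  \<open>\<phi>\<close> can be used like evaluation at a point without being shown
  multiplicative.\<close>

lemma emb_notin_ideal:
  assumes "subalgebra R" "ideal_of R J" "1 \<notin> J" "emb c \<in> J"
  shows "c = 0"
proof (rule ccontr)
  assume "c \<noteq> 0"
  then have "1 = emb (inverse c) * emb c" by (simp flip: hom_mult)
  also have "\<dots> \<in> J" using ideal_of_mult[OF assms(2) subalgebra_emb[OF assms(1)] assms(4)] .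
  finally show False using assms(3) by blast
qed

end

section \<open>Zeros of linear forms on a graded algebra of large growth\<close>

context complex_algebra
begin

lemma span_mult_mem:
  assumes "x \<in> span S" "y \<in> span T" "\<And>s t. s \<in> S \<Longrightarrow> t \<in> T \<Longrightarrow> s * t \<in> span U"
  shows "x * y \<in> span U"
proof -
  have *: "s * y \<in> span U" if "s \<in> S" for s
    using assms(2)
  proof (induction rule: span_induct_alt)
    case base show ?case by (simp add: span_zero)
  next
    case (step c t z)
    have "s * (emb c * t + z) = emb c * (s * t) + s * z" by (simp add: algebra_simps)
    then show ?case using step assms(3)[OF that step(1)] by (simp add: span_add span_scale)
  qed
  show ?thesis
    using assms(1)
  proof (induction rule: span_induct_alt)
    case base show ?case by (simp add: span_zero)
  next
    case (step c s z)
    have "(emb c * s + z) * y = emb c * (s * y) + z * y" by (simp add: algebra_simps)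
    then show ?case using step *[OF step(1)] by (simp add: span_add span_scale)
  qed
qed

end

section \<open>Degree parts of a finitely generated algebra\<close>

locale generated_algebra = complex_algebra emb for emb :: "complex \<Rightarrow> 'a::comm_ring_1" +
  fixes m :: "'i \<Rightarrow> 'a" and A :: "'i set"
  assumes finite_A: "finite A"
begin

text \<open>Monomials are products along words, so multiplication is concatenation and finding a
  high power of a generator is counting letters.\<close>

definition mons :: "nat \<Rightarrow> 'a set" where
  "mons t = (\<lambda>xs. prod_list (map m xs)) ` {xs. set xs \<subseteq> A \<and> length xs = t}"

definition homog :: "nat \<Rightarrow> 'a set" where
  "homog t = span (mons t)"

definition alg :: "'a set" where
  "alg = span (\<Union>t. mons t)"

lemma finite_mons: "finite (mons t)"
  unfolding mons_def by (intro finite_imageI finite_lists_length_eq finite_A)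

lemma mons_mult: "x \<in> mons s \<Longrightarrow> y \<in> mons t \<Longrightarrow> x * y \<in> mons (s + t)"
  unfolding mons_def
proof (elim imageE)
  fix xs ys assume "x = prod_list (map m xs)" "xs \<in> {xs. set xs \<subseteq> A \<and> length xs = s}"
    "y = prod_list (map m ys)" "ys \<in> {ys. set ys \<subseteq> A \<and> length ys = t}"
  then show "x * y \<in> (\<lambda>xs. prod_list (map m xs)) ` {xs. set xs \<subseteq> A \<and> length xs = s + t}"
    by (intro image_eqI[of _ _ "xs @ ys"]) auto
qed

lemma homog_mult: "x \<in> homog s \<Longrightarrow> y \<in> homog t \<Longrightarrow> x * y \<in> homog (s + t)"
  unfolding homog_def by (erule span_mult_mem) (auto intro: span_base mons_mult)

lemma one_homog: "1 \<in> homog 0"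
  unfolding homog_def mons_def by (rule span_base) auto

lemma gen_homog: "a \<in> A \<Longrightarrow> m a \<in> homog 1"
  unfolding homog_def mons_def by (intro span_base image_eqI[of _ _ "[a]"]) auto

lemma homog_power: "x \<in> homog 1 \<Longrightarrow> x ^ t \<in> homog t"
proof (induction t)
  case (Suc t)
  then show ?case using homog_mult[of x 1 "x ^ t" t] by simp
qed (simp add: one_homog)

lemma subspace_homog: "subspace (homog t)"
  unfolding homog_def by (rule subspace_span)

lemma homog_subset: "homog t \<subseteq> alg"
  unfolding homog_def alg_def by (rule span_mono) auto

lemma subalgebra_alg: "subalgebra alg"
  unfolding subalgebra_def
proof (intro conjI ballI)
  show "subspace alg" by (simp add: alg_def)
  show "1 \<in> alg" using one_homog homog_subset by blast
  show "x * y \<in> alg" if "x \<in> alg" "y \<in> alg" for x y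
    using that unfolding alg_def by (rule span_mult_mem) (auto intro!: span_base dest: mons_mult)
qed

lemma alg_decompose:
  assumes "x \<in> alg"
  shows "\<exists>T g. (\<forall>t. g t \<in> homog t) \<and> (\<forall>t>T. g t = 0) \<and> x = (\<Sum>t\<le>T. g t)"
  using assms unfolding alg_def
proof (induction rule: span_induct_alt)
  case base
  show ?case by (intro exI[of _ 0] exI[of _ "\<lambda>_. 0"]) (auto simp: subspace_0[OF subspace_homog])
next
  case (step c x y)
  then obtain T g s where g: "\<forall>t. g t \<in> homog t" "\<forall>t>T. g t = 0" "y = (\<Sum>t\<le>T. g t)"
    and s: "x \<in> mons s" by auto
  define h where "h = (\<lambda>t. g t + (if t = s then emb c * x else 0))"
  have "h t \<in> homog t" for t
    using g(1) s by (auto simp: h_def homog_def intro: span_add span_scale span_base)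
  moreover have "h t = 0" if "t > max T s" for t
    using g(2) that by (auto simp: h_def)
  moreover have "(\<Sum>t\<le>max T s. g t) = y"
    unfolding g(3) using g(2) by (intro sum.mono_neutral_right) auto
  then have "emb c * x + y = (\<Sum>t\<le>max T s. h t)"
    by (simp add: h_def sum.distrib)
  ultimately show ?case by blast
qed

text \<open>Provides the countable exhaustion by finite-dimensional subspaces on which
  \<open>nullstellensatz\<close> rests.\<close>

lemma alg_filtration: "alg \<subseteq> (\<Union>k. span (\<Union>t\<le>k. mons t))"
proof
  fix x assume "x \<in> alg"
  then obtain T g where g: "\<And>t. g t \<in> homog t" "x = (\<Sum>t\<le>T. g t)"
    using alg_decompose by blast
  have "g t \<in> span (\<Union>t\<le>T. mons t)" if "t \<le> T" for t
    using g(1)[of t] span_mono[of "mons t" "\<Union>t\<le>T. mons t"] that unfolding homog_def by blast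
  then have "x \<in> span (\<Union>t\<le>T. mons t)" unfolding g(2) by (intro span_sum) auto
  then show "x \<in> (\<Union>k. span (\<Union>t\<le>k. mons t))" by blast
qed

section \<open>Pigeonhole on words and the ideal generated by forms\<close>

lemma prod_list_split_gen:
  "prod_list (map m xs) = m a ^ count_list xs a * prod_list (map m (filter (\<lambda>x. x \<noteq> a) xs))"
  by (induction xs) (auto simp: algebra_simps)

lemma length_split_gen: "length xs = count_list xs a + length (filter (\<lambda>x. x \<noteq> a) xs)"
  by (induction xs) auto

lemma exists_repeated_letter:
  assumes "set xs \<subseteq> A" "length xs \<ge> card A * s" "length xs > 0" "s > 0"
  shows "\<exists>a\<in>A. count_list xs a \<ge> s"
proof (rule ccontr)
  assume "\<not> ?thesis"
  then have "\<And>a. a \<in> A \<Longrightarrow> count_list xs a < s" by auto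
  moreover have "A \<noteq> {}" using assms(1,3) by auto
  ultimately have "(\<Sum>a\<in>A. count_list xs a) < (\<Sum>a\<in>A. s)"
    using finite_A by (intro sum_strict_mono) auto
  moreover have "(\<Sum>a\<in>A. count_list xs a) = length xs"
    using assms(1) finite_A
    by (subst sum_count_set) auto
  ultimately show False using assms(2) by simp
qed

text \<open>The coefficient set is a parameter: \<open>alg\<close> gives the ideal generated by the
  forms, while \<open>homog s\<close> records that coefficients of degree \<open>s\<close>
  suffice.\<close>

definition form_ideal :: "nat \<Rightarrow> (nat \<Rightarrow> 'a) \<Rightarrow> 'a set \<Rightarrow> 'a set" where
  "form_ideal n f S = {\<Sum>k<n. g k * f k |g. \<forall>k<n. g k \<in> S}"

lemma form_idealI:
  "x = (\<Sum>k<n. g k * f k) \<Longrightarrow> (\<And>k. k < n \<Longrightarrow> g k \<in> S) \<Longrightarrow> x \<in> form_ideal n f S"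
  by (auto simp: form_ideal_def)

lemma form_ideal_add:
  assumes "subspace S" "x \<in> form_ideal n f S" "y \<in> form_ideal n f S"
  shows "x + y \<in> form_ideal n f S"
proof -
  obtain g h where g: "x = (\<Sum>k<n. g k * f k)" "\<forall>k<n. g k \<in> S"
    and h: "y = (\<Sum>k<n. h k * f k)" "\<forall>k<n. h k \<in> S"
    using assms by (auto simp: form_ideal_def)
  have "x + y = (\<Sum>k<n. (g k + h k) * f k)" by (simp add: g h sum.distrib algebra_simps)
  then show ?thesis using g h assms(1) by (intro form_idealI) (auto intro: subspace_add)
qed

lemma form_ideal_mult:
  assumes "x \<in> form_ideal n f S" "\<And>z. z \<in> S \<Longrightarrow> y * z \<in> S'"
  shows "y * x \<in> form_ideal n f S'"
proof -
  obtain g where g: "x = (\<Sum>k<n. g k * f k)" "\<forall>k<n. g k \<in> S"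
    using assms by (auto simp: form_ideal_def)
  have "y * x = (\<Sum>k<n. (y * g k) * f k)" by (simp add: g sum_distrib_left algebra_simps)
  then show ?thesis using g assms(2) by (intro form_idealI) auto
qed

lemma form_ideal_zero: "subspace S \<Longrightarrow> 0 \<in> form_ideal n f S"
  by (rule form_idealI[where g = "\<lambda>_. 0"]) (auto simp: subspace_0)

lemma subspace_form_ideal:
  assumes "subspace S" shows "subspace (form_ideal n f S)"
proof (rule subspaceI)
  show "0 \<in> form_ideal n f S" using assms by (rule form_ideal_zero)
  show "x + y \<in> form_ideal n f S" if "x \<in> form_ideal n f S" "y \<in> form_ideal n f S" for x y
    using assms that by (rule form_ideal_add)
  show "emb c * x \<in> form_ideal n f S" if "x \<in> form_ideal n f S" for c x
    using that by (rule form_ideal_mult) (rule subspace_scale[OF assms])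
qed

lemma form_in_ideal:
  assumes "subspace S" "1 \<in> S" "k < n"
  shows "f k \<in> form_ideal n f S"
proof -
  have "f k = (\<Sum>j<n. (if j = k then 1 else 0) * f j)"
    using assms(3) by (simp add: if_distrib[of "\<lambda>x. x * _"] cong: if_cong)
  then show ?thesis by (rule form_idealI) (use assms(1,2) in \<open>auto simp: subspace_0\<close>)
qed

lemma ideal_of_form_ideal:
  assumes "\<And>k. k < n \<Longrightarrow> f k \<in> alg"
  shows "ideal_of alg (form_ideal n f alg)"
proof -
  have sub: "subspace alg" by (simp add: alg_def)
  have "form_ideal n f alg \<subseteq> alg"
    using assms by (auto simp: form_ideal_def intro!: subspace_sum[OF sub] subalgebra_mult[OF subalgebra_alg])
  then show ?thesis
    unfolding ideal_of_def
    using form_ideal_zero[OF sub] form_ideal_add[OF sub] form_ideal_mult subalgebra_mult[OF subalgebra_alg]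
    by blast
qed

end

text \<open>The assumption \<open>graded\<close> makes the sum of the degree parts direct.
  Generators alone do not ensure this, because they may satisfy inhomogeneous relations.\<close>

locale graded_algebra = generated_algebra emb m A
  for emb :: "complex \<Rightarrow> 'a::comm_ring_1" and m :: "'i \<Rightarrow> 'a" and A +
  assumes graded: "\<And>T g. (\<And>t. g t \<in> homog t) \<Longrightarrow> (\<Sum>t\<le>T. g t) = 0 \<Longrightarrow> \<forall>t\<le>T. g t = 0"
begin

text \<open>Compare the components of degree \<open>Suc s\<close> in a representation of
  \<open>x\<close>: as the forms are linear, only the degree-\<open>s\<close> parts of the
  coefficients contribute.\<close>

lemma homog_form_ideal:
  assumes f: "\<And>k. k < n \<Longrightarrow> f k \<in> homog 1"
    and x: "x \<in> homog (Suc s)" "x \<in> form_ideal n f alg"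
  shows "x \<in> form_ideal n f (homog s)"
proof -
  obtain G where G: "x = (\<Sum>k<n. G k * f k)" "\<And>k. k < n \<Longrightarrow> G k \<in> alg"
    using x(2) by (auto simp: form_ideal_def)
  then have "\<exists>T g. k < n \<longrightarrow> (\<forall>t. g t \<in> homog t) \<and> (\<forall>t>T. g t = 0) \<and> G k = (\<Sum>t\<le>T. g t)" for k
    using alg_decompose by blast
  then obtain T g where g: "\<And>k t. k < n \<Longrightarrow> g k t \<in> homog t"
    "\<And>k t. k < n \<Longrightarrow> t > T k \<Longrightarrow> g k t = 0" "\<And>k. k < n \<Longrightarrow> G k = (\<Sum>t\<le>T k. g k t)"
    by metis
  \<comment> \<open>One degree bound for all coefficients; the summand \<open>s\<close> ensures that
    the degree of \<open>x\<close> is within range.\<close>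
  define M where "M = s + (\<Sum>k<n. T k)"
  have TM: "T k \<le> M" if "k < n" for k
    unfolding M_def using that by (intro trans_le_add2 member_le_sum) auto
  have GM: "G k = (\<Sum>t\<le>M. g k t)" if "k < n" for k
    unfolding g(3)[OF that] using TM[OF that] g(2)[OF that] by (intro sum.mono_neutral_left) auto
  define F where "F = (\<lambda>t. \<Sum>k<n. g k t * f k)"
  have F: "F t \<in> homog (Suc t)" for t
    unfolding F_def using g(1) f homog_mult[of _ t _ 1]
    by (intro subspace_sum[OF subspace_homog]) auto
  \<comment> \<open>The degree-\<open>t\<close> part of \<open>x\<close> minus its representation;
    the case distinction is the degree shift by a linear form.\<close>
  define h where "h = (\<lambda>t. (if t = Suc s then x else 0) - (case t of 0 \<Rightarrow> 0 | Suc t \<Rightarrow> F t))"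
  have hh: "h t \<in> homog t" for t
    unfolding h_def using x(1) F
    by (intro subspace_diff[OF subspace_homog]) (auto simp: subspace_0[OF subspace_homog] split: nat.split)
  have "(\<Sum>t\<le>Suc M. h t) = 0"
  proof -
    have "(\<Sum>t\<le>Suc M. h t) = (\<Sum>t\<le>Suc M. if t = Suc s then x else 0)
        - (\<Sum>t\<le>Suc M. case t of 0 \<Rightarrow> 0 | Suc t \<Rightarrow> F t)"
      unfolding h_def by (rule sum_subtractf)
    also have "(\<Sum>t\<le>Suc M. if t = Suc s then x else 0) = x" by (subst sum.delta) (auto simp: M_def)
    also have "(\<Sum>t\<le>Suc M. case t of 0 \<Rightarrow> 0 | Suc t \<Rightarrow> F t) = (\<Sum>t\<le>M. F t)"
      by (subst sum.atMost_Suc_shift) simp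
    also have "\<dots> = (\<Sum>k<n. \<Sum>t\<le>M. g k t * f k)"
      unfolding F_def by (rule sum.swap)
    also have "\<dots> = x" unfolding G(1)
      by (intro sum.cong) (auto simp: GM sum_distrib_right)
    finally show ?thesis by simp
  qed
  then have "\<forall>t\<le>Suc M. h t = 0" using hh by (intro graded)
  moreover have "Suc s \<le> Suc M" by (simp add: M_def)
  ultimately have "h (Suc s) = 0" by blast
  then have "x = F s" by (simp add: h_def)
  then show ?thesis unfolding F_def by (rule form_idealI) (rule g(1))
qed

text \<open>A word this long repeats some letter \<open>Suc s\<close> times. That power is a
  combination of the forms with degree-\<open>s\<close> coefficients, and the remaining letters
  raise the coefficients to degree \<open>t\<close>.\<close>

lemma homog_in_form_ideal_large:
  assumes s: "\<And>a. a \<in> A \<Longrightarrow> m a ^ Suc s \<in> form_ideal n f (homog s)"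
    and t: "Suc t \<ge> card A * Suc s"
  shows "homog (Suc t) \<subseteq> form_ideal n f (homog t)"
proof -
  have "mons (Suc t) \<subseteq> form_ideal n f (homog t)"
  proof
    fix x assume "x \<in> mons (Suc t)"
    then obtain xs where xs: "set xs \<subseteq> A" "length xs = Suc t" "x = prod_list (map m xs)"
      by (auto simp: mons_def)
    obtain a where a: "a \<in> A" "count_list xs a \<ge> Suc s"
      using exists_repeated_letter[OF xs(1), of "Suc s"] t xs(2) by auto
    define ys where "ys = filter (\<lambda>x. x \<noteq> a) xs"
    define c where "c = count_list xs a - Suc s"
    have c: "count_list xs a = c + Suc s" using a(2) by (simp add: c_def)
    have len: "t = s + (c + length ys)"
      using length_split_gen[of xs a] xs(2) c by (simp add: ys_def)
    have "prod_list (map m ys) \<in> homog (length ys)"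
      unfolding homog_def mons_def using xs(1) by (intro span_base image_eqI[of _ _ ys]) (auto simp: ys_def)
    then have rest: "m a ^ c * prod_list (map m ys) \<in> homog (c + length ys)"
      using homog_power[OF gen_homog[OF a(1)]] by (intro homog_mult)
    have "x = (m a ^ c * prod_list (map m ys)) * m a ^ Suc s"
      unfolding xs(3) prod_list_split_gen[of xs a] c ys_def[symmetric]
      by (simp add: power_add algebra_simps)
    also have "\<dots> \<in> form_ideal n f (homog t)"
      using s[OF a(1)] by (rule form_ideal_mult) (use homog_mult[OF _ rest] len in \<open>simp add: mult.commute\<close>)
    finally show "x \<in> form_ideal n f (homog t)" .
  qed
  then show ?thesis
    unfolding homog_def[of "Suc t"]
    by (rule span_minimal) (rule subspace_form_ideal[OF subspace_homog])
qed

text \<open>Products of \<open>j\<close> of the \<open>n + 1\<close> forms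
  \<open>f 0, ..., f n\<close> with a monomial of degree \<open>t\<close>. The exponent of
  \<open>f n\<close> is determined by the others, so only \<open>n\<close> exponents are free; this
  saves the decisive power of \<open>j\<close> in \<open>card_form_mons\<close>.\<close>

definition form_mons :: "nat \<Rightarrow> (nat \<Rightarrow> 'a) \<Rightarrow> nat \<Rightarrow> nat \<Rightarrow> 'a set" where
  "form_mons n f t j = (\<lambda>(\<alpha>, b). (\<Prod>k<n. f k ^ \<alpha> k) * f n ^ (j - (\<Sum>k<n. \<alpha> k)) * b) `
     ({\<alpha> \<in> {..<n} \<rightarrow>\<^sub>E {..j}. (\<Sum>k<n. \<alpha> k) \<le> j} \<times> mons t)"

lemma finite_form_mons: "finite (form_mons n f t j)"
proof -
  have "finite {\<alpha> \<in> {..<n} \<rightarrow>\<^sub>E {..j}. (\<Sum>k<n. \<alpha> k) \<le> j}"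
    by (rule finite_subset[of _ "{..<n} \<rightarrow>\<^sub>E {..j}"]) (auto intro: finite_PiE)
  then show ?thesis unfolding form_mons_def
    by (intro finite_imageI finite_cartesian_product finite_mons)
qed

lemma card_form_mons: "card (form_mons n f t j) \<le> Suc j ^ n * card (mons t)"
proof -
  let ?E = "{\<alpha> \<in> {..<n} \<rightarrow>\<^sub>E {..j}. (\<Sum>k<n. \<alpha> k) \<le> j}"
  have fin: "finite ({..<n} \<rightarrow>\<^sub>E {..j})" by (intro finite_PiE) auto
  then have "finite ?E" by (rule rev_finite_subset) auto
  then have "card (form_mons n f t j) \<le> card (?E \<times> mons t)"
    unfolding form_mons_def by (intro card_image_le finite_cartesian_product finite_mons)
  also have "\<dots> = card ?E * card (mons t)" by (rule card_cartesian_product)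
  also have "card ?E \<le> card ({..<n} \<rightarrow>\<^sub>E {..j})" by (rule card_mono[OF fin]) auto
  also have "\<dots> = Suc j ^ n" by (simp add: card_PiE)
  finally show ?thesis by simp
qed

text \<open>Multiplying by \<open>f n\<close> raises its implicit exponent; multiplying by another
  form leaves it unchanged, since \<open>j\<close> and the sum of the other exponents grow
  together.\<close>

lemma form_mons_mult:
  assumes "k < Suc n" "x \<in> form_mons n f t j"
  shows "f k * x \<in> form_mons n f t (Suc j)"
proof -
  obtain \<alpha> b where \<alpha>: "\<alpha> \<in> {..<n} \<rightarrow>\<^sub>E {..j}" "(\<Sum>k<n. \<alpha> k) \<le> j" "b \<in> mons t"
    and x: "x = (\<Prod>k<n. f k ^ \<alpha> k) * f n ^ (j - (\<Sum>k<n. \<alpha> k)) * b"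
    using assms(2) by (auto simp: form_mons_def)
  show ?thesis
  proof (cases "k = n")
    case True
    have "f k * x = (\<Prod>k<n. f k ^ \<alpha> k) * f n ^ (Suc j - (\<Sum>k<n. \<alpha> k)) * b"
      using \<alpha>(2) True by (simp add: x Suc_diff_le algebra_simps)
    moreover have "\<alpha> \<in> {..<n} \<rightarrow>\<^sub>E {..Suc j}" using \<alpha>(1) by (auto simp: PiE_iff le_Suc_eq)
    ultimately show ?thesis unfolding form_mons_def using \<alpha> by (intro image_eqI[of _ _ "(\<alpha>, b)"]) auto
  next
    case False
    then have k: "k < n" using assms(1) by simp
    define \<beta> where "\<beta> = \<alpha>(k := Suc (\<alpha> k))"
    have "(\<Sum>i<n. \<beta> i) = \<beta> k + (\<Sum>i\<in>{..<n} - {k}. \<beta> i)" using k by (intro sum.remove) auto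
    also have "(\<Sum>i\<in>{..<n} - {k}. \<beta> i) = (\<Sum>i\<in>{..<n} - {k}. \<alpha> i)"
      by (intro sum.cong) (auto simp: \<beta>_def)
    also have "\<beta> k + \<dots> = Suc (\<Sum>i<n. \<alpha> i)" using k by (simp add: sum.remove[of _ k] \<beta>_def)
    finally have sum: "(\<Sum>i<n. \<beta> i) = Suc (\<Sum>i<n. \<alpha> i)" .
    have "(\<Prod>i<n. f i ^ \<beta> i) = f k ^ \<beta> k * (\<Prod>i\<in>{..<n} - {k}. f i ^ \<beta> i)"
      using k by (intro prod.remove) auto
    also have "(\<Prod>i\<in>{..<n} - {k}. f i ^ \<beta> i) = (\<Prod>i\<in>{..<n} - {k}. f i ^ \<alpha> i)"
      by (intro prod.cong) (auto simp: \<beta>_def)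
    also have "f k ^ \<beta> k * \<dots> = f k * (\<Prod>i<n. f i ^ \<alpha> i)"
      using k by (simp add: prod.remove[of _ k] \<beta>_def mult.assoc)
    finally have "f k * x = (\<Prod>k<n. f k ^ \<beta> k) * f n ^ (Suc j - (\<Sum>k<n. \<beta> k)) * b"
      by (simp add: x sum algebra_simps)
    moreover have "\<beta> \<in> {..<n} \<rightarrow>\<^sub>E {..Suc j}"
      using \<alpha>(1) k by (auto simp: PiE_iff \<beta>_def extensional_def intro: le_SucI)
    ultimately show ?thesis unfolding form_mons_def using \<alpha> sum
      by (intro image_eqI[of _ _ "(\<beta>, b)"]) auto
  qed
qed

text \<open>Lowering the degree one step at a time, from \<open>t0 + j\<close> to \<open>t0\<close>,
  splits off \<open>j\<close> forms.\<close>

lemma homog_subset_span_form_mons: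
  assumes "\<And>t. t \<ge> t0 \<Longrightarrow> homog (Suc t) \<subseteq> form_ideal (Suc n) f (homog t)"
  shows "homog (t0 + j) \<subseteq> span (form_mons n f t0 j)"
proof (induction j)
  case 0
  have "mons t0 \<subseteq> form_mons n f t0 0"
  proof
    fix b assume "b \<in> mons t0"
    then show "b \<in> form_mons n f t0 0"
      unfolding form_mons_def
      by (intro image_eqI[of _ _ "(restrict (\<lambda>_. 0) {..<n}, b)"]) auto
  qed
  then show ?case by (simp add: homog_def span_mono)
next
  case (Suc j)
  show ?case
  proof
    fix x assume "x \<in> homog (t0 + Suc j)"
    then have "x \<in> form_ideal (Suc n) f (homog (t0 + j))" using assms[of "t0 + j"] by auto
    then obtain g where g: "x = (\<Sum>k<Suc n. g k * f k)" "\<And>k. k < Suc n \<Longrightarrow> g k \<in> homog (t0 + j)"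
      by (auto simp: form_ideal_def)
    have "g k * f k \<in> span (form_mons n f t0 (Suc j))" if "k < Suc n" for k
    proof (rule span_mult_mem)
      show "g k \<in> span (form_mons n f t0 j)" using g(2)[OF that] Suc.IH by blast
      show "f k \<in> span {f k}" by (simp add: span_base)
    qed (use form_mons_mult[OF that, of _ f t0 j] in \<open>auto simp: mult.commute[of _ "f k"] intro!: span_base\<close>)
    then show "x \<in> span (form_mons n f t0 (Suc j))" unfolding g(1) by (intro span_sum) auto
  qed
qed

text \<open>If the forms had no common zero, the Nullstellensatz would make \<open>homog t\<close> grow only like
  \<open>t ^ (n - 1)\<close>.\<close>

theorem forms_have_common_zero:
  assumes f: "\<And>k. k < n \<Longrightarrow> f k \<in> homog 1" and n: "n > 0"
    and growth: "\<And>r. \<exists>h. (\<forall>e<r ^ n. h e \<in> homog (n * r)) \<and>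
      (\<forall>l. (\<Sum>e<r ^ n. emb (l e) * h e) = 0 \<longrightarrow> (\<forall>e<r ^ n. l e = 0))"
  shows "\<exists>J \<phi>. ideal_of alg J \<and> (\<forall>k<n. f k \<in> J) \<and> 1 \<notin> J \<and> (\<exists>a\<in>A. \<phi> (m a) \<noteq> 0) \<and>
           (\<forall>x\<in>alg. x - emb (\<phi> x) \<in> J)"
proof (cases "\<exists>a\<in>A. \<forall>s. m a ^ s \<notin> form_ideal n f alg")
  case True
  then obtain a where a: "a \<in> A" "\<And>s. m a ^ s \<notin> form_ideal n f alg" by blast
  have f': "f k \<in> alg" if "k < n" for k using f[OF that] homog_subset by blast
  have m: "m a \<in> alg" using gen_homog[OF a(1)] homog_subset by blast
  have "finite (\<Union>t\<le>k. mons t)" for k using finite_mons by blast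
  then obtain J \<phi> where J: "ideal_of alg J" "form_ideal n f alg \<subseteq> J" "1 \<notin> J" "\<phi> (m a) \<noteq> 0"
    "\<forall>x\<in>alg. x - emb (\<phi> x) \<in> J"
    using nullstellensatz[OF subalgebra_alg ideal_of_form_ideal[of n f, OF f'] m a(2) alg_filtration]
    by blast
  have "f k \<in> J" if "k < n" for k
    using form_in_ideal[of alg k n f] that J(2) subalgebra_alg by (auto simp: subalgebra_def)
  with J a(1) show ?thesis by blast
next
  case False
  \<comment> \<open>Every generator now has a power in the ideal of the forms; \<open>S\<close>
    makes one exponent work for all, with coefficients of known degree.\<close>
  then obtain s where s: "\<And>a. a \<in> A \<Longrightarrow> m a ^ s a \<in> form_ideal n f alg" by metis
  define S where "S = (\<Sum>a\<in>A. s a)"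
  have S: "m a ^ Suc S \<in> form_ideal n f (homog S)" if a: "a \<in> A" for a
  proof -
    have "s a \<le> Suc S" unfolding S_def using a finite_A by (intro le_SucI member_le_sum) auto
    then have "m a ^ Suc S = m a ^ (Suc S - s a) * m a ^ s a" by (simp flip: power_add)
    also have "\<dots> \<in> form_ideal n f alg"
      using s[OF a] by (rule form_ideal_mult)
        (use gen_homog[OF a] homog_subset in \<open>auto intro!: subalgebra_mult[OF subalgebra_alg] subalgebra_power[OF subalgebra_alg]\<close>)
    finally show ?thesis
      using homog_form_ideal[of n f, OF f] homog_power[OF gen_homog[OF a]] by blast
  qed
  obtain n' where n': "n = Suc n'" using n by (cases n) auto
  define t0 where "t0 = card A * Suc S"
  have large: "homog (Suc t) \<subseteq> form_ideal (Suc n') f (homog t)" if "t \<ge> t0" for t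
    using homog_in_form_ideal_large[of S n f t, OF S] that by (simp add: t0_def n')
  define K where "K = card (mons t0)"
  \<comment> \<open>Large enough that the monomial count \<open>(2 * n * r) ^ n' * K\<close> is
    below \<open>r ^ n\<close> and that degree \<open>n * r\<close> is at least
    \<open>t0\<close>.\<close>
  define r where "r = (2 * n) ^ n' * K + t0 + 1"
  define j where "j = n * r - t0"
  have r: "r \<ge> 1" "r \<ge> t0" by (simp_all add: r_def)
  then have nr: "n * r = t0 + j" "Suc j \<le> 2 * n * r"
    using n by (auto simp: j_def n')
  obtain h where h: "\<And>e. e < r ^ n \<Longrightarrow> h e \<in> homog (n * r)"
    and indep: "\<And>l. (\<Sum>e<r ^ n. emb (l e) * h e) = 0 \<Longrightarrow> \<forall>e<r ^ n. l e = 0"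
    using growth[of r] by blast
  have "card (form_mons n' f t0 j) \<le> Suc j ^ n' * K"
    unfolding K_def by (rule card_form_mons)
  also have "\<dots> \<le> (2 * n * r) ^ n' * K" using nr(2) by (intro mult_right_mono power_mono) auto
  also have "\<dots> = r ^ n' * ((2 * n) ^ n' * K)" by (simp add: power_mult_distrib)
  also have "\<dots> < r ^ n' * r" using r(1) by (intro mult_strict_left_mono) (auto simp: r_def)
  finally have "card (form_mons n' f t0 j) < card {..<r ^ n}" by (simp add: n' mult.commute)
  moreover have "h ` {..<r ^ n} \<subseteq> span (form_mons n' f t0 j)"
    using h homog_subset_span_form_mons[of t0 n' f j, OF large] nr(1) by auto
  ultimately obtain l where "\<exists>e\<in>{..<r ^ n}. l e \<noteq> 0" "(\<Sum>e<r ^ n. emb (l e) * h e) = 0"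
    using exists_dependency[of "{..<r ^ n}" "form_mons n' f t0 j" h] finite_form_mons by blast
  with indep show ?thesis by blast
qed

end

section \<open>Product vectors in the kernel of few linear forms\<close>

locale tensor_space =
  fixes p :: nat and d :: "nat \<Rightarrow> nat"
  assumes p_pos: "p \<ge> 1" and d_pos: "\<And>k. k \<in> {1..p} \<Longrightarrow> d k > 0"
begin

abbreviation "N \<equiv> tensor_dim p d"
abbreviation "dig \<equiv> digit p d"
abbreviation "enc \<equiv> encode p d"

lemma dig_less: "k \<in> {1..p} \<Longrightarrow> dig i k < d k"
  using d_pos by (simp add: digit_def)

lemma enc_cong: "(\<And>k. k \<in> {1..p} \<Longrightarrow> f k = g k) \<Longrightarrow> enc f = enc g"
  by (simp add: encode_def)

lemma eq_if_digits_eq: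
  assumes "i < N" "j < N" "\<And>k. k \<in> {1..p} \<Longrightarrow> dig i k = dig j k"
  shows "i = j"
  using encode_digit[OF assms(1)] encode_digit[OF assms(2)] enc_cong[of "dig i" "dig j"] assms(3)
  by simp

lemma N_pos: "N > 0"
  unfolding tensor_dim_def using d_pos by (intro prod_pos) auto

text \<open>The coordinates of a product vector, as functions of its factors, generate the homogeneous
  coordinate ring of the Segre variety.\<close>

definition segre :: "nat \<Rightarrow> (nat \<Rightarrow> nat \<Rightarrow> complex) \<Rightarrow> complex" where
  "segre a x = (\<Prod>k=1..p. x k (dig a k))"

lemma segre_enc:
  assumes "\<And>k. k \<in> {1..p} \<Longrightarrow> f k < d k"
  shows "segre (enc f) x = (\<Prod>k=1..p. x k (f k))"
  unfolding segre_def using digit_encode[of p f d] assms by (intro prod.cong) auto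

abbreviation const :: "complex \<Rightarrow> (nat \<Rightarrow> nat \<Rightarrow> complex) \<Rightarrow> complex" where
  "const c \<equiv> \<lambda>_. c"

sublocale S: generated_algebra const segre "{..<N}"
  by unfold_locales (auto simp: fun_eq_iff)

text \<open>Scaling one factor of a product vector scales every coordinate by \<open>z\<close>.
  Elements of different degree then appear with different powers of \<open>z\<close>, which proves
  the grading.\<close>

lemma homog_scale:
  assumes "g \<in> S.homog t"
  shows "g (x(1 := \<lambda>i. z * x 1 i)) = z ^ t * g x"
proof -
  define y where "y = x(1 := \<lambda>i. z * x 1 i)"
  have seg: "segre a y = z * segre a x" for a
  proof -
    have "segre a y = y 1 (dig a 1) * (\<Prod>k\<in>{1..p} - {1}. y k (dig a k))"
      unfolding segre_def using p_pos by (intro prod.remove) auto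
    also have "(\<Prod>k\<in>{1..p} - {1}. y k (dig a k)) = (\<Prod>k\<in>{1..p} - {1}. x k (dig a k))"
      by (intro prod.cong) (auto simp: y_def)
    also have "y 1 (dig a 1) * \<dots> = z * (x 1 (dig a 1) * \<dots>)" by (simp add: y_def)
    also have "x 1 (dig a 1) * (\<Prod>k\<in>{1..p} - {1}. x k (dig a k)) = segre a x"
      unfolding segre_def using p_pos by (intro prod.remove[symmetric]) auto
    finally show ?thesis .
  qed
  have mon: "prod_list (map segre as) y = z ^ length as * prod_list (map segre as) x" for as
    by (induction as) (auto simp: seg)
  show ?thesis
    using assms unfolding S.homog_def y_def[symmetric]
    by (induction rule: S.span_induct_alt) (auto simp: S.mons_def mon algebra_simps)
qed

lemma sum_fun_apply: "(\<Sum>t\<in>T. g t) x = (\<Sum>t\<in>T. g t x)" for g :: "'i \<Rightarrow> 'b \<Rightarrow> complex"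
  by (induction T rule: infinite_finite_induct) auto

lemma polyfun_zero_coeffs:
  assumes "finite E" "\<And>z::complex. (\<Sum>e\<in>E. l e * z ^ e) = 0" "e \<in> E"
  shows "l e = 0"
proof -
  define q where "q = (\<Sum>e\<in>E. monom (l e) e)"
  have "poly q z = 0" for z using assms(2) by (simp add: q_def poly_sum poly_monom)
  then have "q = 0" using poly_all_0_iff_0 by blast
  moreover have "coeff q e = l e" using assms(1,3) by (simp add: q_def coeff_sum)
  ultimately show ?thesis by simp
qed

sublocale S: graded_algebra const segre "{..<N}"
proof
  fix T and g :: "nat \<Rightarrow> (nat \<Rightarrow> nat \<Rightarrow> complex) \<Rightarrow> complex"
  assume g: "\<And>t. g t \<in> S.homog t" "(\<Sum>t\<le>T. g t) = 0"
  have "g t x = 0" if "t \<le> T" for t x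
  proof (rule polyfun_zero_coeffs[of "{..T}" "\<lambda>t. g t x"])
    fix z
    have "(\<Sum>t\<le>T. g t x * z ^ t) = (\<Sum>t\<le>T. g t) (x(1 := \<lambda>i. z * x 1 i))"
      unfolding sum_fun_apply homog_scale[OF g(1)] by (simp add: mult.commute)
    then show "(\<Sum>t\<le>T. g t x * z ^ t) = 0" by (simp add: g(2))
  qed (use that in auto)
  then show "\<forall>t\<le>T. g t = 0" by (auto simp: fun_eq_iff)
qed

section \<open>Growth of the Segre coordinate ring\<close>

abbreviation "n \<equiv> \<Sum>k=1..p. d k - 1"

text \<open>A Kronecker substitution: in the affine chart where every factor has 0-th entry 1, the
  \<open>n\<close> remaining entries are the free coordinates. Along the curve \<open>X r\<close>
  the coordinate number \<open>l\<close> takes the value \<open>z ^ (r ^ l)\<close>, and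
  \<open>u l\<close> is the index with just the corresponding nonzero digit.\<close>

lemma exists_unit_indices:
  "\<exists>u X. \<forall>r. (\<forall>l<n. u l < N \<and> (\<forall>z. segre (u l) (X r z) = z ^ (r ^ l))) \<and>
     (\<forall>z. segre 0 (X r z) = 1)"
proof -
  define L where "L = (SIGMA k:{1..p}. {1..<d k})"
  have "finite L" "card L = n" by (simp_all add: L_def)
  then obtain \<iota> where \<iota>: "bij_betw \<iota> {..<n} L"
    using ex_bij_betw_nat_finite[of L] by (auto simp: lessThan_atLeast0)
  define \<kappa> where "\<kappa> = the_inv_into {..<n} \<iota>"
  have inj: "inj_on \<iota> {..<n}" using \<iota> by (rule bij_betw_imp_inj_on)
  define e where "e = (\<lambda>l k. if k = fst (\<iota> l) then snd (\<iota> l) else 0)"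
  define X where "X = (\<lambda>r (z::complex) k i. if i = 0 then 1 else z ^ (r ^ \<kappa> (k, i)))"
  have segre_u: "enc (e l) < N \<and> segre (enc (e l)) (X r z) = z ^ (r ^ l)" if l: "l < n" for l r z
  proof -
    have \<iota>l: "\<iota> l \<in> L" using \<iota> l by (auto simp: bij_betw_def)
    then have lt: "\<And>k. k \<in> {1..p} \<Longrightarrow> e l k < d k" using d_pos by (auto simp: e_def L_def)
    have fst: "fst (\<iota> l) \<in> {1..p}" using \<iota>l by (auto simp: L_def)
    have "segre (enc (e l)) (X r z) = (\<Prod>k=1..p. X r z k (e l k))"
      using lt by (rule segre_enc)
    also have "\<dots> = X r z (fst (\<iota> l)) (e l (fst (\<iota> l))) * (\<Prod>k\<in>{1..p} - {fst (\<iota> l)}. X r z k (e l k))"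
      using fst by (intro prod.remove) auto
    also have "(\<Prod>k\<in>{1..p} - {fst (\<iota> l)}. X r z k (e l k)) = 1"
      by (intro prod.neutral) (auto simp: e_def X_def)
    also have "X r z (fst (\<iota> l)) (e l (fst (\<iota> l))) = z ^ (r ^ l)"
      using \<iota>l the_inv_into_f_f[OF inj, of l] l by (auto simp: X_def e_def L_def \<kappa>_def)
    finally show ?thesis using encode_less[of p "e l" d] lt by simp
  qed
  have "segre 0 (X r z) = 1" for r z
    by (simp add: segre_def digit_def X_def)
  with segre_u show ?thesis by (intro exI[of _ "\<lambda>l. enc (e l)"] exI[of _ X]) auto
qed

text \<open>Writing \<open>e\<close> in base \<open>r\<close> gives a monomial in the coordinates
  \<open>u l\<close> that restricts to \<open>z ^ e\<close> on the curve. Distinct powers of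
  \<open>z\<close> are independent, hence so are the \<open>r ^ n\<close> monomials.\<close>

lemma segre_growth:
  "\<exists>h. (\<forall>e<r ^ n. h e \<in> S.homog (n * r)) \<and>
      (\<forall>l. (\<Sum>e<r ^ n. const (l e) * h e) = 0 \<longrightarrow> (\<forall>e<r ^ n. l e = 0))"
proof -
  obtain u X where u: "\<And>l. l < n \<Longrightarrow> u l < N"
      "\<And>l z. l < n \<Longrightarrow> segre (u l) (X r z) = z ^ (r ^ l)" "\<And>z. segre 0 (X r z) = 1"
    using exists_unit_indices by metis
  have base: "\<exists>h\<in>S.homog (q * r). \<forall>z. h (X r z) = z ^ e" if "q \<le> n" "e < r ^ q" for q e
    using that
  proof (induction q arbitrary: e)
    case 0
    then show ?case using S.one_homog by (intro bexI[of _ 1]) auto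
  next
    case (Suc q)
    then have r: "r > 0" by (cases r) auto
    define b where "b = e div r ^ q"
    have b: "b < r" using Suc.prems(2) by (simp add: b_def less_mult_imp_div_less)
    have e: "e = r ^ q * b + e mod r ^ q" by (simp add: b_def)
    obtain h where h: "h \<in> S.homog (q * r)" "\<And>z. h (X r z) = z ^ (e mod r ^ q)"
      using Suc.IH[of "e mod r ^ q"] Suc.prems(1) r by auto
    have q: "q < n" using Suc.prems(1) by simp
    \<comment> \<open>The factor \<open>segre 0\<close> is 1 on the curve and pads each
      base-\<open>r\<close> digit to degree exactly \<open>r\<close>.\<close>
    define h' where "h' = h * (segre (u q) ^ b * segre 0 ^ (r - b))"
    have "h' \<in> S.homog (q * r + (b + (r - b)))"
      unfolding h'_def using u(1)[OF q] N_pos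
      by (intro S.homog_mult h(1) S.homog_power S.gen_homog) auto
    moreover have "q * r + (b + (r - b)) = Suc q * r" using b by simp
    moreover have pow: "(F ^ s) x = F x ^ s" for F :: "(nat \<Rightarrow> nat \<Rightarrow> complex) \<Rightarrow> complex" and s x
      by (induction s) auto
    have "h' (X r z) = z ^ e" for z
    proof -
      have "h' (X r z) = z ^ (e mod r ^ q) * (z ^ (r ^ q)) ^ b"
        by (simp add: h'_def h(2) pow u(2)[OF q] u(3))
      also have "\<dots> = z ^ (r ^ q * b + e mod r ^ q)" by (simp add: power_add power_mult)
      finally show ?thesis using e by simp
    qed
    ultimately show ?case by auto
  qed
  then have "\<forall>e. \<exists>h. e < r ^ n \<longrightarrow> h \<in> S.homog (n * r) \<and> (\<forall>z. h (X r z) = z ^ e)"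
    by blast
  then obtain h where h: "\<And>e. e < r ^ n \<Longrightarrow> h e \<in> S.homog (n * r)"
    "\<And>e z. e < r ^ n \<Longrightarrow> h e (X r z) = z ^ e" by metis
  have "l e = 0" if l: "(\<Sum>e<r ^ n. const (l e) * h e) = 0" and e: "e < r ^ n" for l e
  proof (rule polyfun_zero_coeffs[of "{..<r ^ n}" l])
    fix z
    have "(\<Sum>e<r ^ n. l e * z ^ e) = (\<Sum>e<r ^ n. const (l e) * h e) (X r z)"
      unfolding sum_fun_apply by (intro sum.cong) (auto simp: h(2))
    then show "(\<Sum>e<r ^ n. l e * z ^ e) = 0" by (simp only: l zero_fun_apply)
  qed (use e in auto)
  with h(1) show ?thesis by blast
qed

text \<open>The exchange relations are the quadratic equations of the Segre variety.\<close>

lemma product_form_of_exchange_relations: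
  assumes rel: "\<And>f g j. j \<in> {1..p} \<Longrightarrow> (\<And>k. k \<in> {1..p} \<Longrightarrow> f k < d k \<and> g k < d k) \<Longrightarrow>
      c (enc f) * c (enc g) = c (enc (f(j := g j))) * c (enc (g(j := f j)))"
    and a0: "a0 < N" "c a0 \<noteq> (0::complex)"
  shows "\<exists>y. \<forall>a<N. c a = c a0 * segre a y"
proof -
  \<comment> \<open>Factor \<open>k\<close> is read off by varying only digit \<open>k\<close> of
    the reference index \<open>a0\<close>, normalised by \<open>c a0\<close>.\<close>
  define y where "y = (\<lambda>k i. c (enc ((dig a0)(k := i))) / c a0)"
  have "c a = c a0 * segre a y" if a: "a < N" for a
  proof -
    \<comment> \<open>Hybrid indices interpolate from \<open>a0\<close> to \<open>a\<close>; one
      exchange relation with \<open>a0\<close> links consecutive ones.\<close>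
    define H where "H = (\<lambda>q k. if k \<le> q then dig a k else dig a0 k)"
    have H: "H q k < d k" if "k \<in> {1..p}" for q k using dig_less[OF that] by (simp add: H_def)
    have step: "c (enc (H q)) = c a0 * (\<Prod>k=1..q. y k (dig a k))" if "q \<le> p" for q
      using that
    proof (induction q)
      case 0
      have "enc (H 0) = enc (dig a0)" by (rule enc_cong) (auto simp: H_def)
      then show ?case using encode_digit[OF a0(1)] by simp
    next
      case (Suc q)
      let ?j = "Suc q"
      have "c (enc (H ?j)) * c (enc (dig a0))
          = c (enc ((H ?j)(?j := dig a0 ?j))) * c (enc ((dig a0)(?j := H ?j ?j)))"
        using Suc.prems H dig_less by (intro rel) auto
      also have "(H ?j)(?j := dig a0 ?j) = H q" by (auto simp: H_def fun_eq_iff le_Suc_eq)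
      also have "c (enc ((dig a0)(?j := H ?j ?j))) = c a0 * y ?j (dig a ?j)"
        using a0(2) by (simp add: y_def H_def)
      finally have "c (enc (H ?j)) * c a0 = c (enc (H q)) * (c a0 * y ?j (dig a ?j))"
        using encode_digit[OF a0(1)] by simp
      then show ?case using Suc.IH Suc.prems a0(2) by (simp add: algebra_simps)
    qed
    have "enc (H p) = enc (dig a)" by (rule enc_cong) (auto simp: H_def)
    then show ?thesis using step[of p] encode_digit[OF a] by (simp add: segre_def)
  qed
  then show ?thesis by blast
qed

text \<open>The values \<open>c a\<close> are the coordinates of the common zero. The coordinate
  functions satisfy the exchange relations, so modulo \<open>J\<close> the scalars do too, and the
  point is a nonzero multiple of a product vector.\<close>

theorem product_vector_in_kernel_pos:
  assumes n: "n > 0"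
  shows "\<exists>y. (\<exists>a<N. segre a y \<noteq> 0) \<and> (\<forall>k<n. (\<Sum>a<N. w k a * segre a y) = 0)"
proof -
  define f where "f = (\<lambda>k. \<Sum>a<N. const (w k a) * segre a)"
  have f: "f k \<in> S.homog 1" for k
    unfolding f_def using S.gen_homog
    by (intro S.subspace_sum[OF S.subspace_homog] S.subspace_scale[OF S.subspace_homog]) auto
  obtain J \<phi> a0 where J: "S.ideal_of S.alg J" "1 \<notin> J" "\<And>k. k < n \<Longrightarrow> f k \<in> J"
    and a0: "a0 < N" "\<phi> (segre a0) \<noteq> 0" and \<phi>: "\<And>x. x \<in> S.alg \<Longrightarrow> x - const (\<phi> x) \<in> J"
    using S.forms_have_common_zero[of n f, OF f n segre_growth] by auto
  define c where "c = (\<lambda>a. \<phi> (segre a))"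
  have alg: "segre a \<in> S.alg" if "a < N" for a
    using S.gen_homog[of a] S.homog_subset that by auto
  have c: "segre a - const (c a) \<in> J" if "a < N" for a
    unfolding c_def using \<phi> alg[OF that] by blast
  have zero: "z = 0" if "const z \<in> J" for z
    using S.emb_notin_ideal[OF S.subalgebra_alg J(1,2)] that by blast
  have mult: "segre a * segre b - const (c a * c b) \<in> J" if "a < N" "b < N" for a b
  proof -
    have "segre b * (segre a - const (c a)) + const (c a) * (segre b - const (c b)) \<in> J"
      by (intro S.ideal_of_add[OF J(1)] S.ideal_of_mult[OF J(1)] alg c that
          S.subalgebra_emb[OF S.subalgebra_alg])
    also have "segre b * (segre a - const (c a)) + const (c a) * (segre b - const (c b))
        = segre a * segre b - const (c a * c b)"
      by (auto simp: fun_eq_iff algebra_simps)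
    finally show ?thesis .
  qed
  have "\<exists>y. \<forall>a<N. c a = c a0 * segre a y"
  proof (rule product_form_of_exchange_relations)
    fix g h :: "nat \<Rightarrow> nat" and j
    assume j: "j \<in> {1..p}" and gh: "\<And>k. k \<in> {1..p} \<Longrightarrow> g k < d k \<and> h k < d k"
    let ?g = "g(j := h j)" and ?h = "h(j := g j)"
    have lt: "enc g < N" "enc h < N" "enc ?g < N" "enc ?h < N"
      using gh by (auto intro!: encode_less)
    have "segre (enc g) * segre (enc h) = segre (enc ?g) * segre (enc ?h)"
    proof
      fix x
      have lt: "\<And>k. k \<in> {1..p} \<Longrightarrow> g k < d k" "\<And>k. k \<in> {1..p} \<Longrightarrow> h k < d k"
        "\<And>k. k \<in> {1..p} \<Longrightarrow> ?g k < d k" "\<And>k. k \<in> {1..p} \<Longrightarrow> ?h k < d k"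
        using gh by (simp_all split: if_splits)
      have "segre (enc g) x = (\<Prod>k=1..p. x k (g k))" "segre (enc h) x = (\<Prod>k=1..p. x k (h k))"
        "segre (enc ?g) x = (\<Prod>k=1..p. x k (?g k))" "segre (enc ?h) x = (\<Prod>k=1..p. x k (?h k))"
        by (rule segre_enc, erule lt)+
      then show "(segre (enc g) * segre (enc h)) x = (segre (enc ?g) * segre (enc ?h)) x"
        by (simp only: times_fun_apply prod.distrib[symmetric]) (rule prod.cong, auto)
    qed
    then have "const (c (enc g) * c (enc h)) - const (c (enc ?g) * c (enc ?h)) \<in> J"
      using S.ideal_of_diff[OF S.subalgebra_alg J(1) mult[OF lt(3,4)] mult[OF lt(1,2)]] by simp
    also have "const (c (enc g) * c (enc h)) - const (c (enc ?g) * c (enc ?h))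
        = const (c (enc g) * c (enc h) - c (enc ?g) * c (enc ?h))" by (simp add: fun_eq_iff)
    finally show "c (enc g) * c (enc h) = c (enc ?g) * c (enc ?h)" using zero by fastforce
  qed (use a0 in \<open>auto simp: c_def\<close>)
  then obtain y where y: "\<And>a. a < N \<Longrightarrow> c a = c a0 * segre a y" by blast
  have "c a0 \<noteq> 0" using a0 by (simp add: c_def)
  moreover have "(\<Sum>a<N. w k a * c a) = 0" if "k < n" for k
  proof -
    have "(\<Sum>a<N. const (w k a) * (segre a - const (c a))) \<in> J"
      using c by (intro S.ideal_of_sum[OF J(1)] S.ideal_of_mult[OF J(1)]
          S.subalgebra_emb[OF S.subalgebra_alg]) auto
    then have "f k - (\<Sum>a<N. const (w k a) * (segre a - const (c a))) \<in> J"
      by (intro S.ideal_of_diff[OF S.subalgebra_alg J(1) J(3)[OF that]])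
    also have "f k - (\<Sum>a<N. const (w k a) * (segre a - const (c a))) = const (\<Sum>a<N. w k a * c a)"
      by (auto simp: f_def fun_eq_iff sum_fun_apply algebra_simps sum_subtractf)
    finally show ?thesis by (rule zero)
  qed
  moreover have "(\<Sum>a<N. w k a * c a) = c a0 * (\<Sum>a<N. w k a * segre a y)" for k
    unfolding sum_distrib_left by (intro sum.cong) (auto simp: y)
  ultimately show ?thesis using a0(1) y[OF a0(1)] by (intro exI[of _ y]) auto
qed

theorem product_vector_in_kernel:
  assumes "finite Q" "card Q \<le> n"
  shows "\<exists>y. (\<exists>a<N. segre a y \<noteq> 0) \<and> (\<forall>q\<in>Q. (\<Sum>a<N. w q a * segre a y) = 0)"
proof (cases "n > 0")
  case True
  obtain h where h: "bij_betw h {0..<card Q} Q" using ex_bij_betw_nat_finite[OF assms(1)] by blast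
  \<comment> \<open>For \<open>card Q \<le> k < n\<close> the value \<open>h k\<close> is arbitrary;
    the forms it gives are harmless padding.\<close>
  obtain y where y: "\<exists>a<N. segre a y \<noteq> 0" "\<And>k. k < n \<Longrightarrow> (\<Sum>a<N. w (h k) a * segre a y) = 0"
    using product_vector_in_kernel_pos[OF True, of "\<lambda>k. w (h k)"] by blast
  have "(\<Sum>a<N. w q a * segre a y) = 0" if "q \<in> Q" for q
  proof -
    have "q \<in> h ` {0..<card Q}" using h that by (simp add: bij_betw_def)
    then obtain k where "k < card Q" "q = h k" by auto
    then show ?thesis using y(2)[of k] assms(2) by simp
  qed
  with y(1) show ?thesis by blast
next
  case False
  then have "Q = {}" using assms by simp
  then show ?thesis using N_pos by (intro exI[of _ "\<lambda>_ _. 1"]) (auto simp: segre_def)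
qed

end

section \<open>Counting negative eigenvalues\<close>

definition quad_form :: "nat \<Rightarrow> complex mat \<Rightarrow> (nat \<Rightarrow> complex) \<Rightarrow> complex" where
  "quad_form n W v = (\<Sum>i<n. \<Sum>j<n. cnj (v i) * W $$ (i, j) * v j)"

lemma spectral_quad_form:
  assumes W: "W \<in> carrier_mat N N"
    and herm: "\<And>i j. i < N \<Longrightarrow> j < N \<Longrightarrow> W $$ (j, i) = cnj (W $$ (i, j))"
  shows "\<exists>u e. (\<forall>v. quad_form N W v = complex_of_real (\<Sum>i<N. e i * (cmod (\<Sum>a<N. v a * u i a))\<^sup>2)) \<and>
           (\<forall>v. (\<forall>i<N. (\<Sum>a<N. v a * u i a) = 0) \<longrightarrow> (\<forall>a<N. v a = 0)) \<and>
           num_neg_eigenvalues W = card {i. i < N \<and> e i < 0}"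
proof -
  obtain u e where
    w: "\<And>k l. k < N \<Longrightarrow> l < N \<Longrightarrow> W $$ (k, l) = (\<Sum>i<N. complex_of_real (e i) * u i k * cnj (u i l))"
    and u: "\<And>k l. k < N \<Longrightarrow> l < N \<Longrightarrow> (\<Sum>i<N. u i k * cnj (u i l)) = (if k = l then 1 else 0)"
    and nn: "num_neg_eigenvalues W = card {i. i < N \<and> e i < 0}"
  proof -
    have "\<exists>u e. (\<forall>k<N. \<forall>l<N. W $$ (k, l) = (\<Sum>i<N. complex_of_real (e i) * u i k * cnj (u i l))) \<and>
           (\<forall>k<N. \<forall>l<N. (\<Sum>i<N. u i k * cnj (u i l)) = (if k = l then 1 else 0)) \<and>
           num_neg_eigenvalues W = card {i. i < N \<and> e i < 0}"
      using W by (rule spectral_theorem) (rule herm)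
    then show thesis using that by blast
  qed
  define c where "c = (\<lambda>v i. \<Sum>a<N. v a * cnj (u i a))"
  have qf: "quad_form N W v = complex_of_real (\<Sum>i<N. e i * (cmod (c v i))\<^sup>2)" for v
  proof -
    have "quad_form N W v = (\<Sum>k<N. \<Sum>l<N. \<Sum>i<N.
        complex_of_real (e i) * (cnj (v k) * u i k) * (v l * cnj (u i l)))"
      unfolding quad_form_def
      by (intro sum.cong refl) (simp add: w sum_distrib_left sum_distrib_right algebra_simps)
    also have "\<dots> = (\<Sum>k<N. \<Sum>i<N. \<Sum>l<N.
        complex_of_real (e i) * (cnj (v k) * u i k) * (v l * cnj (u i l)))"
      by (rule sum.cong[OF refl], rule sum.swap)
    also have "\<dots> = (\<Sum>i<N. \<Sum>k<N. \<Sum>l<N.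
        complex_of_real (e i) * (cnj (v k) * u i k) * (v l * cnj (u i l)))"
      by (rule sum.swap)
    also have "\<dots> = (\<Sum>i<N. complex_of_real (e i) * (cnj (c v i) * c v i))"
    proof -
      have "cnj (c v i) * c v i = (\<Sum>k<N. \<Sum>l<N. (cnj (v k) * u i k) * (v l * cnj (u i l)))" for i
        unfolding c_def cnj_sum complex_cnj_mult complex_cnj_cnj sum_product ..
      then show ?thesis by (simp only: sum_distrib_left mult.assoc)
    qed
    also have "\<dots> = complex_of_real (\<Sum>i<N. e i * (cmod (c v i))\<^sup>2)"
      unfolding of_real_sum of_real_mult complex_norm_square by (simp add: mult.commute)
    finally show ?thesis .
  qed
  have inj: "v a = 0" if v: "\<forall>i<N. c v i = 0" and a: "a < N" for v a
  proof -
    have "v a = (\<Sum>b<N. v b * (if a = b then 1 else 0))" using a by (simp add: if_distrib cong: if_cong)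
    also have "\<dots> = (\<Sum>b<N. v b * (\<Sum>i<N. u i a * cnj (u i b)))"
      using a by (intro sum.cong refl) (simp add: u)
    also have "\<dots> = (\<Sum>b<N. \<Sum>i<N. u i a * (v b * cnj (u i b)))"
      by (simp add: sum_distrib_left algebra_simps)
    also have "\<dots> = (\<Sum>i<N. \<Sum>b<N. u i a * (v b * cnj (u i b)))" by (rule sum.swap)
    also have "\<dots> = (\<Sum>i<N. u i a * c v i)" by (simp add: c_def sum_distrib_left)
    also have "\<dots> = 0" using v by simp
    finally show ?thesis .
  qed
  have "(\<forall>v. quad_form N W v = complex_of_real (\<Sum>i<N. e i * (cmod (c v i))\<^sup>2)) \<and>
      (\<forall>v. (\<forall>i<N. c v i = 0) \<longrightarrow> (\<forall>a<N. v a = 0)) \<and>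
      num_neg_eigenvalues W = card {i. i < N \<and> e i < 0}"
    using qf inj nn by blast
  \<comment> \<open>The eigenvectors are conjugated so that the spectral coordinates are linear in
    \<open>v\<close>.\<close>
  then show ?thesis unfolding c_def by (intro exI[of _ "\<lambda>i a. cnj (u i a)"] exI[of _ e])
qed

text \<open>Otherwise a nonzero vector is killed by all forms of \<open>Q\<close> and by the
  coordinates of all negative eigenvalues, so the quadratic form is both negative and nonnegative
  there.\<close>

lemma num_neg_eigenvalues_lower_bound:
  assumes W: "W \<in> carrier_mat N N"
    and herm: "\<And>i j. i < N \<Longrightarrow> j < N \<Longrightarrow> W $$ (j, i) = cnj (W $$ (i, j))"
    and Q: "finite Q"
    and neg: "\<And>v. \<exists>a<N. v a \<noteq> 0 \<Longrightarrow> (\<And>q. q \<in> Q \<Longrightarrow> (\<Sum>a<N. v a * w q a) = 0) \<Longrightarrow> Re (quad_form N W v) < 0"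
  shows "N \<le> num_neg_eigenvalues W + card Q"
proof (rule ccontr)
  assume less: "\<not> ?thesis"
  obtain u e where qf: "\<And>v. quad_form N W v = complex_of_real (\<Sum>i<N. e i * (cmod (\<Sum>a<N. v a * u i a))\<^sup>2)"
    and nn: "num_neg_eigenvalues W = card {i. i < N \<and> e i < 0}"
    using spectral_quad_form[OF W herm] by blast
  define M where "M = {i. i < N \<and> e i < 0}"
  have M: "finite M" by (simp add: M_def)
  have "card (Q <+> M) < card {..<N}"
    using less Q M nn by (simp add: card_Plus M_def)
  then obtain v where v: "\<exists>i\<in>{..<N}. v i \<noteq> 0" "\<forall>q\<in>Q <+> M. (\<Sum>i<N. v i * case_sum w u q i) = 0"
    using exists_nontrivial_solution[of "Q <+> M" "{..<N}" "case_sum w u"] Q M by auto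
  have "(\<Sum>a<N. v a * w q a) = 0" if "q \<in> Q" for q
    using bspec[OF v(2) InlI[OF that]] by simp
  then have "Re (quad_form N W v) < 0" using v(1) by (intro neg) auto
  moreover have "0 \<le> (\<Sum>i<N. e i * (cmod (\<Sum>a<N. v a * u i a))\<^sup>2)"
  proof (intro sum_nonneg)
    fix i assume "i \<in> {..<N}"
    show "0 \<le> e i * (cmod (\<Sum>a<N. v a * u i a))\<^sup>2"
    proof (cases "e i < 0")
      case True
      then have "Inr i \<in> Q <+> M" using \<open>i \<in> {..<N}\<close> by (auto simp: M_def)
      then have "(\<Sum>a<N. v a * u i a) = 0" using bspec[OF v(2), of "Inr i"] by simp
      then show ?thesis by simp
    qed simp
  qed
  ultimately show False unfolding qf by simp
qed

lemma psd_carrier: "positive_semidefinite n X \<Longrightarrow> X \<in> carrier_mat n n"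
  by (simp add: positive_semidefinite_def)

lemma mat_adjoint_index:
  "i < dim_col X \<Longrightarrow> j < dim_row X \<Longrightarrow> mat_adjoint X $$ (i, j) = cnj (X $$ (j, i))"
  for X :: "complex mat"
  by (simp add: mat_adjoint_def mat_of_rows_index)

lemma psd_hermitian:
  assumes "positive_semidefinite n X" "i < n" "j < n"
  shows "X $$ (j, i) = cnj (X $$ (i, j))"
proof -
  have "X \<in> carrier_mat n n" "mat_adjoint X = X" using assms by (auto simp: positive_semidefinite_def)
  then show ?thesis using mat_adjoint_index[of j X i] assms(2,3) by auto
qed

lemma quad_form_eq_inner:
  assumes "X \<in> carrier_mat n n" "w \<in> carrier_vec n"
  shows "(X *\<^sub>v w) \<bullet>c w = quad_form n X (\<lambda>i. w $ i)"
  using assms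
  by (simp add: quad_form_def scalar_prod_def lessThan_atLeast0 sum_distrib_left sum_distrib_right
      algebra_simps)

lemma psd_quad_form_nonneg:
  assumes "positive_semidefinite n X" shows "0 \<le> quad_form n X v"
proof -
  have "0 \<le> (X *\<^sub>v vec n v) \<bullet>c vec n v" using assms by (simp add: positive_semidefinite_def)
  also have "\<dots> = quad_form n X (\<lambda>i. vec n v $ i)"
    using psd_carrier[OF assms] by (intro quad_form_eq_inner) auto
  also have "\<dots> = quad_form n X v" unfolding quad_form_def by (intro sum.cong refl) auto
  finally show ?thesis .
qed

lemma psdI:
  assumes X: "X \<in> carrier_mat n n"
    and herm: "\<And>i j. i < n \<Longrightarrow> j < n \<Longrightarrow> X $$ (j, i) = cnj (X $$ (i, j))"
    and nonneg: "\<And>v. 0 \<le> quad_form n X v"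
  shows "positive_semidefinite n X"
  unfolding positive_semidefinite_def
proof (intro conjI ballI)
  show "mat_adjoint X = X"
  proof (rule eq_matI)
    fix i j assume "i < dim_row X" "j < dim_col X"
    then have ij: "i < n" "j < n" using X by auto
    then show "mat_adjoint X $$ (i, j) = X $$ (i, j)"
      using mat_adjoint_index[of i X j] herm[OF ij(2,1)] X by simp
  qed (use X in \<open>auto simp: mat_adjoint_def\<close>)
qed (use X quad_form_eq_inner nonneg in auto)

lemma quad_form_mat_sum:
  assumes "finite I" "\<And>a. a \<in> I \<Longrightarrow> F a \<in> carrier_mat n n"
  shows "quad_form n (mat_sum n F I) v = (\<Sum>a\<in>I. quad_form n (F a) v)"
proof -
  have "quad_form n (mat_sum n F I) v
      = (\<Sum>i<n. \<Sum>j<n. \<Sum>a\<in>I. cnj (v i) * F a $$ (i, j) * v j)"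
    unfolding quad_form_def using index_mat_sum[of I F n, OF assms]
    by (intro sum.cong refl) (simp add: sum_distrib_left sum_distrib_right)
  also have "\<dots> = (\<Sum>i<n. \<Sum>a\<in>I. \<Sum>j<n. cnj (v i) * F a $$ (i, j) * v j)"
    by (intro sum.cong refl) (rule sum.swap)
  also have "\<dots> = (\<Sum>a\<in>I. quad_form n (F a) v)"
    unfolding quad_form_def by (rule sum.swap)
  finally show ?thesis .
qed

section \<open>Partial transposes\<close>

context tensor_space
begin

definition mix :: "nat set \<Rightarrow> nat \<Rightarrow> nat \<Rightarrow> nat" where
  "mix A i j = enc (\<lambda>k. if k \<in> A then dig j k else dig i k)"

lemma mix_less: "mix A i j < N"
  unfolding mix_def by (intro encode_less) (auto simp: dig_less)

lemma dig_mix: "k \<in> {1..p} \<Longrightarrow> dig (mix A i j) k = (if k \<in> A then dig j k else dig i k)"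
  unfolding mix_def by (subst digit_encode) (auto simp: dig_less)

lemma mix_mix: "i < N \<Longrightarrow> mix A (mix A i j) (mix A j i) = i"
  by (rule eq_if_digits_eq) (auto simp: mix_less dig_mix)

lemma mix_self: "i < N \<Longrightarrow> mix A i i = i"
  by (rule eq_if_digits_eq) (auto simp: mix_less dig_mix)

lemma partial_transpose_carrier: "partial_transpose p d A X \<in> carrier_mat N N"
  by (simp add: partial_transpose_def)

lemma partial_transpose_index:
  "i < N \<Longrightarrow> j < N \<Longrightarrow> partial_transpose p d A X $$ (i, j) = X $$ (mix A i j, mix A j i)"
  by (simp add: partial_transpose_def mix_def)

text \<open>Exchanging the \<open>A\<close>-digits of two indices is an involution on pairs;
  reindexing by it moves a partial transposition from the matrix to the vectors.\<close>

lemma sum_mix_reindex: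
  "(\<Sum>i<N. \<Sum>j<N. F (mix A i j) (mix A j i) i j) = (\<Sum>i<N. \<Sum>j<N. F i j (mix A i j) (mix A j i))"
  unfolding sum.cartesian_product
  by (rule sum.reindex_bij_witness[of _ "\<lambda>(i, j). (mix A i j, mix A j i)" "\<lambda>(i, j). (mix A i j, mix A j i)"])
    (auto simp: mix_mix mix_less)

lemma quad_form_partial_transpose:
  "quad_form N (partial_transpose p d A X) v
    = (\<Sum>i<N. \<Sum>j<N. cnj (v (mix A i j)) * X $$ (i, j) * v (mix A j i))"
proof -
  have "quad_form N (partial_transpose p d A X) v
      = (\<Sum>i<N. \<Sum>j<N. cnj (v i) * X $$ (mix A i j, mix A j i) * v j)"
    unfolding quad_form_def by (intro sum.cong refl) (simp add: partial_transpose_index)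
  then show ?thesis using sum_mix_reindex[of "\<lambda>e f i j. cnj (v i) * X $$ (e, f) * v j" A] by simp
qed

lemma partial_transpose_hermitian:
  assumes "positive_semidefinite N X" "i < N" "j < N"
  shows "partial_transpose p d A X $$ (j, i) = cnj (partial_transpose p d A X $$ (i, j))"
  unfolding partial_transpose_index[OF assms(3,2)] partial_transpose_index[OF assms(2,3)]
  by (rule psd_hermitian[OF assms(1) mix_less mix_less])

lemma quad_form_partial_transpose_product:
  assumes X: "positive_semidefinite N X"
  shows "0 \<le> quad_form N (partial_transpose p d A X) (\<lambda>a. segre a y)"
proof -
  define z where "z = (\<lambda>k i. if k \<in> A then cnj (y k i) else y k i)"
  \<comment> \<open>In each factor of \<open>A\<close> the exchanged digits swap the conjugated
    entry with the plain one, which amounts to conjugating \<open>y k\<close>.\<close>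
  have "cnj (segre (mix A i j) y) * segre (mix A j i) y = cnj (segre i z) * segre j z" for i j
    unfolding segre_def cnj_prod prod.distrib[symmetric]
    by (rule prod.cong) (auto simp: dig_mix z_def)
  then have *: "cnj (segre (mix A i j) y) * x * segre (mix A j i) y = cnj (segre i z) * x * segre j z" for i j x
    by (metis mult.assoc mult.commute)
  have "quad_form N (partial_transpose p d A X) (\<lambda>a. segre a y) = quad_form N X (\<lambda>a. segre a z)"
    unfolding quad_form_partial_transpose unfolding quad_form_def by (intro sum.cong refl *)
  then show ?thesis using psd_quad_form_nonneg[OF X] by simp
qed

text \<open>Otherwise at most \<open>n\<close> eigenvalues are nonnegative, and some nonzero product
  vector has vanishing coordinates at all of them; the form would be negative on it.\<close>

lemma num_neg_eigenvalues_upper_bound: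
  assumes W: "W \<in> carrier_mat N N"
    and herm: "\<And>i j. i < N \<Longrightarrow> j < N \<Longrightarrow> W $$ (j, i) = cnj (W $$ (i, j))"
    and nonneg: "\<And>y. 0 \<le> quad_form N W (\<lambda>a. segre a y)"
  shows "num_neg_eigenvalues W + n + 1 \<le> N"
proof (rule ccontr)
  assume less: "\<not> ?thesis"
  obtain u e where qf: "\<And>v. quad_form N W v = complex_of_real (\<Sum>i<N. e i * (cmod (\<Sum>a<N. v a * u i a))\<^sup>2)"
    and inj: "\<And>v. (\<forall>i<N. (\<Sum>a<N. v a * u i a) = 0) \<Longrightarrow> (\<forall>a<N. v a = 0)"
    and nn: "num_neg_eigenvalues W = card {i. i < N \<and> e i < 0}"
    using spectral_quad_form[OF W herm] by blast
  define Q where "Q = {i. i < N \<and> \<not> e i < 0}"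
  have "card {i. i < N \<and> e i < 0} + card Q = card ({i. i < N \<and> e i < 0} \<union> Q)"
    by (rule card_Un_disjoint[symmetric]) (auto simp: Q_def)
  also have "{i. i < N \<and> e i < 0} \<union> Q = {..<N}" by (auto simp: Q_def)
  finally have "card Q \<le> n" using less nn by simp
  moreover have "finite Q" by (simp add: Q_def)
  ultimately obtain y where y: "\<exists>a<N. segre a y \<noteq> 0" "\<And>q. q \<in> Q \<Longrightarrow> (\<Sum>a<N. u q a * segre a y) = 0"
    using product_vector_in_kernel[of Q u] by blast
  define c where "c = (\<lambda>i. \<Sum>a<N. segre a y * u i a)"
  have cQ: "c q = 0" if "q \<in> Q" for q using y(2)[OF that] by (simp add: c_def mult.commute)
  have "\<not> (\<forall>i<N. c i = 0)" using inj[of "\<lambda>a. segre a y"] y(1) unfolding c_def by blast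
  then obtain i where i: "i < N" "c i \<noteq> 0" by blast
  then have ei: "e i < 0" using cQ by (auto simp: Q_def)
  have "(\<Sum>i<N. e i * (cmod (c i))\<^sup>2) = e i * (cmod (c i))\<^sup>2 + (\<Sum>j\<in>{..<N} - {i}. e j * (cmod (c j))\<^sup>2)"
    using i(1) by (intro sum.remove) auto
  moreover have "e j * (cmod (c j))\<^sup>2 \<le> 0" if "j < N" for j
  proof (cases "e j < 0")
    case True then show ?thesis by (simp add: mult_nonpos_nonneg)
  next
    case False then show ?thesis using cQ[of j] that by (simp add: Q_def)
  qed
  then have "(\<Sum>j\<in>{..<N} - {i}. e j * (cmod (c j))\<^sup>2) \<le> 0" by (intro sum_nonpos) auto
  moreover have "e i * (cmod (c i))\<^sup>2 < 0" using ei i(2) by (simp add: mult_neg_pos)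
  moreover have "0 \<le> (\<Sum>i<N. e i * (cmod (c i))\<^sup>2)"
    using nonneg[of y] unfolding qf by (simp add: c_def less_eq_complex_def)
  ultimately show False by linarith
qed

text \<open>The index type is arbitrary so that this covers both the sum over all subsets and the
  witness with its single-factor transpositions.\<close>

lemma sum_partial_transposes:
  fixes A :: "'i \<Rightarrow> nat set"
  assumes "finite I" "\<And>a. a \<in> I \<Longrightarrow> positive_semidefinite N (X a)"
  defines "W \<equiv> mat_sum N (\<lambda>a. partial_transpose p d (A a) (X a)) I"
  shows "W \<in> carrier_mat N N"
    and "\<And>i j. i < N \<Longrightarrow> j < N \<Longrightarrow> W $$ (j, i) = cnj (W $$ (i, j))"
    and "\<And>v. quad_form N W v = (\<Sum>a\<in>I. quad_form N (partial_transpose p d (A a) (X a)) v)"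
    and "num_neg_eigenvalues W + n + 1 \<le> N"
proof -
  note * = index_mat_sum[of I "\<lambda>a. partial_transpose p d (A a) (X a)" N, OF assms(1) partial_transpose_carrier]
  show W: "W \<in> carrier_mat N N" using * by (simp add: W_def)
  show herm: "W $$ (j, i) = cnj (W $$ (i, j))" if "i < N" "j < N" for i j
  proof -
    have "W $$ (j, i) = (\<Sum>a\<in>I. partial_transpose p d (A a) (X a) $$ (j, i))"
      using * that by (simp add: W_def)
    also have "\<dots> = (\<Sum>a\<in>I. cnj (partial_transpose p d (A a) (X a) $$ (i, j)))"
      using that assms(2) by (intro sum.cong refl partial_transpose_hermitian)
    also have "\<dots> = cnj (W $$ (i, j))" using * that by (simp add: W_def)
    finally show ?thesis .
  qed
  show qf: "quad_form N W v = (\<Sum>a\<in>I. quad_form N (partial_transpose p d (A a) (X a)) v)" for v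
    unfolding W_def by (rule quad_form_mat_sum[OF assms(1) partial_transpose_carrier])
  show "num_neg_eigenvalues W + n + 1 \<le> N"
    using W herm
  proof (rule num_neg_eigenvalues_upper_bound)
    show "0 \<le> quad_form N W (\<lambda>a. segre a y)" for y
      unfolding qf using assms(2) by (intro sum_nonneg quad_form_partial_transpose_product)
  qed
qed

end

section \<open>A witness with the maximal number of negative eigenvalues\<close>

context tensor_space
begin

definition digit_sum :: "nat \<Rightarrow> nat" where
  "digit_sum a = (\<Sum>k=1..p. dig a k)"

lemma digit_sum_le: "digit_sum a \<le> n"
  unfolding digit_sum_def
proof (rule sum_mono)
  fix k assume "k \<in> {1..p}"
  then show "dig a k \<le> d k - 1" using dig_less[of k a] by linarith
qed

text \<open>Pairs are ordered: for fixed \<open>a\<close> the second components run over all other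
  indices of the same digit sum.\<close>

definition partners :: "(nat \<times> nat) set" where
  "partners = {(a, b). a < N \<and> b < N \<and> a \<noteq> b \<and> digit_sum a = digit_sum b}"

definition lead :: "nat \<times> nat \<Rightarrow> nat" where
  "lead \<pi> = (SOME k. k \<in> {1..p - 1} \<and> dig (fst \<pi>) k \<noteq> dig (snd \<pi>) k)"

lemma finite_partners: "finite partners" and card_partners: "card partners \<le> N * N"
proof -
  have sub: "partners \<subseteq> {..<N} \<times> {..<N}" by (auto simp: partners_def)
  then show "finite partners" by (rule finite_subset) auto
  show "card partners \<le> N * N" using card_mono[OF _ sub] by (simp add: card_cartesian_product)
qed

text \<open>Two indices agreeing in all digits but the last one also agree in the last one if their digit
  sums are equal, so the last subsystem never has to be transposed.\<close>

lemma lead_partners: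
  assumes "(a, b) \<in> partners"
  shows "lead (a, b) \<in> {1..p - 1}" "dig a (lead (a, b)) \<noteq> dig b (lead (a, b))"
proof -
  have ab: "a < N" "b < N" "a \<noteq> b" "digit_sum a = digit_sum b" using assms by (auto simp: partners_def)
  have "\<exists>k. k \<in> {1..p - 1} \<and> dig a k \<noteq> dig b k"
  proof (rule ccontr)
    assume "\<not> ?thesis"
    then have eq: "dig a k = dig b k" if "k \<in> {1..p - 1}" for k using that by blast
    have "{1..p} = insert p {1..p - 1}" using p_pos by auto
    moreover have "p \<notin> {1..p - 1}" using p_pos by auto
    ultimately have "digit_sum c = dig c p + (\<Sum>k\<in>{1..p - 1}. dig c k)" for c
      by (simp add: digit_sum_def)
    moreover have "(\<Sum>k\<in>{1..p - 1}. dig a k) = (\<Sum>k\<in>{1..p - 1}. dig b k)"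
      using eq by (rule sum.cong[OF refl])
    ultimately have "dig a p = dig b p" using ab(4) by simp
    then have "dig a k = dig b k" if "k \<in> {1..p}" for k
      using eq[of k] that by (cases "k = p") auto
    then have "a = b" using eq_if_digits_eq[OF ab(1,2)] by blast
    with ab(3) show False ..
  qed
  then have "lead (a, b) \<in> {1..p - 1} \<and> dig a (lead (a, b)) \<noteq> dig b (lead (a, b))"
    unfolding lead_def fst_conv snd_conv by (rule someI_ex)
  then show "lead (a, b) \<in> {1..p - 1}" "dig a (lead (a, b)) \<noteq> dig b (lead (a, b))" by auto
qed

text \<open>Exchanging one digit moves the two digit sums by opposite amounts.\<close>

lemma digit_sum_mix:
  assumes "(a, b) \<in> partners" "j = lead (a, b)"
  shows "\<exists>E\<ge>1. (digit_sum (mix {j} a b))\<^sup>2 + (digit_sum (mix {j} b a))\<^sup>2 = 2 * (digit_sum a)\<^sup>2 + 2 * E"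
proof -
  have j: "j \<in> {1..p}" "dig a j \<noteq> dig b j" using lead_partners[OF assms(1)] assms(2) by auto
  have rem: "digit_sum c = dig c j + (\<Sum>k\<in>{1..p} - {j}. dig c k)" for c
    unfolding digit_sum_def using j(1) by (intro sum.remove) auto
  have m: "digit_sum (mix {j} c c') = dig c' j + (\<Sum>k\<in>{1..p} - {j}. dig c k)" for c c'
    unfolding rem using j(1) by (auto simp: dig_mix intro!: sum.cong)
  have s: "digit_sum b = digit_sum a" using assms(1) by (simp add: partners_def)
  define t where "t = int (dig b j) - int (dig a j)"
  have 1: "int (digit_sum (mix {j} a b)) = int (digit_sum a) + t"
    unfolding m rem[of a] t_def by simp
  have 2: "int (digit_sum (mix {j} b a)) = int (digit_sum a) - t"
    unfolding s[symmetric] m rem[of b] t_def by simp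
  have t: "t\<^sup>2 \<ge> 1" using j(2) by (simp add: t_def int_one_le_iff_zero_less)
  have "int ((digit_sum (mix {j} a b))\<^sup>2 + (digit_sum (mix {j} b a))\<^sup>2)
      = int (2 * (digit_sum a)\<^sup>2 + 2 * nat (t\<^sup>2))"
    unfolding of_nat_add of_nat_power 1 2 by (simp add: power2_eq_square algebra_simps)
  then show ?thesis using t by (intro exI[of _ "nat (t\<^sup>2)"]) (auto simp only: of_nat_eq_iff nat_le_eq_zle)
qed

text \<open>The square of the difference \<delta> of the exchanged digits: (s - \<delta>)^2 + (s +
  \<delta>)^2 = 2 s^2 + 2 \<delta>^2.\<close>

definition shift :: "nat \<times> nat \<Rightarrow> nat" where
  "shift \<pi> = (SOME E. E \<ge> 1 \<and> (digit_sum (mix {lead \<pi>} (fst \<pi>) (snd \<pi>)))\<^sup>2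
     + (digit_sum (mix {lead \<pi>} (snd \<pi>) (fst \<pi>)))\<^sup>2 = 2 * (digit_sum (fst \<pi>))\<^sup>2 + 2 * E)"

lemma shift:
  assumes "(a, b) \<in> partners"
  defines "j \<equiv> lead (a, b)"
  shows "shift (a, b) \<ge> 1"
    "(digit_sum (mix {j} a b))\<^sup>2 + (digit_sum (mix {j} b a))\<^sup>2 = 2 * (digit_sum a)\<^sup>2 + 2 * shift (a, b)"
  using someI_ex[OF digit_sum_mix[OF assms(1) refl, unfolded Bex_def]]
  unfolding shift_def j_def fst_conv snd_conv by auto

text \<open>After transposition in the factor \<open>lead \<pi>\<close>, the rank-one matrix of the vector \<open>amp \<pi>\<close> couples the
  two partners with the weight \<open>\<mu> ^ (2 s\<^sup>2)\<close> of their digit sum \<open>s\<close>, at a diagonal cost which, by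
  convexity of the exponent, is smaller than the weights of the digit sums it falls on.\<close>

definition \<mu> :: real where "\<mu> = 2 * real N"

definition amp :: "nat \<times> nat \<Rightarrow> nat \<Rightarrow> real" where
  "amp \<pi> i = (if i = mix {lead \<pi>} (fst \<pi>) (snd \<pi>) \<or> i = mix {lead \<pi>} (snd \<pi>) (fst \<pi>)
     then \<mu> ^ (digit_sum i)\<^sup>2 / \<mu> ^ shift \<pi> else 0)"

definition weight :: "nat \<Rightarrow> real" where
  "weight i = \<mu> ^ (2 * (digit_sum i)\<^sup>2)"

lemma \<mu>_pos: "\<mu> > 0" using N_pos by (simp add: \<mu>_def)

lemma weight_pos: "weight i > 0" using \<mu>_pos by (simp add: weight_def)

text \<open>The division by \<open>\<mu> ^ shift\<close> in \<open>amp\<close> cancels the convexity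
  excess of the exponents exactly, leaving a weight independent of the exchanged digits.\<close>

lemma amp_mult:
  assumes "(a, b) \<in> partners"
  shows "amp (a, b) (mix {lead (a, b)} a b) * amp (a, b) (mix {lead (a, b)} b a) = weight a"
proof -
  let ?s = "(digit_sum (mix {lead (a, b)} a b))\<^sup>2" and ?t = "(digit_sum (mix {lead (a, b)} b a))\<^sup>2"
  have "amp (a, b) (mix {lead (a, b)} a b) * amp (a, b) (mix {lead (a, b)} b a)
      = \<mu> ^ (?s + ?t) / \<mu> ^ (2 * shift (a, b))"
    by (simp add: amp_def power_add mult_2)
  also have "\<dots> = weight a"
    unfolding shift(2)[OF assms] using \<mu>_pos by (simp add: weight_def power_add)
  finally show ?thesis .
qed

lemma amp_square:
  assumes "(a, b) \<in> partners"
  shows "(amp (a, b) i)\<^sup>2 \<le> weight i / \<mu>\<^sup>2"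
proof -
  have \<mu>1: "\<mu> \<ge> 1" using N_pos by (simp add: \<mu>_def)
  have "\<mu>\<^sup>2 \<le> \<mu> ^ (2 * shift (a, b))"
    using \<mu>1 shift(1)[OF assms] by (intro power_increasing) auto
  then have "weight i / \<mu> ^ (2 * shift (a, b)) \<le> weight i / \<mu>\<^sup>2"
    using weight_pos[of i] \<mu>_pos by (intro divide_left_mono mult_pos_pos) auto
  moreover have "(amp (a, b) i)\<^sup>2 \<le> weight i / \<mu> ^ (2 * shift (a, b))"
    using weight_pos[of i] \<mu>_pos
    by (auto simp: amp_def weight_def power_divide power_mult[symmetric] mult.commute)
  ultimately show ?thesis by linarith
qed

text \<open>All pairs with the same transposed factor are gathered in one matrix, so that
  \<open>p - 1\<close> matrices suffice.\<close>

definition block :: "nat \<Rightarrow> complex mat" where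
  "block j = mat N N (\<lambda>(i, l). \<Sum>\<pi>\<in>{\<pi>\<in>partners. lead \<pi> = j}. complex_of_real (amp \<pi> i * amp \<pi> l))"

lemma block_psd: "positive_semidefinite N (block j)"
proof (rule psdI)
  fix v
  let ?P = "{\<pi>\<in>partners. lead \<pi> = j}"
  have "quad_form N (block j) v
      = (\<Sum>i<N. \<Sum>l<N. \<Sum>\<pi>\<in>?P. (cnj (v i) * complex_of_real (amp \<pi> i)) * (v l * complex_of_real (amp \<pi> l)))"
    unfolding quad_form_def block_def
    by (intro sum.cong refl) (simp add: sum_distrib_left sum_distrib_right algebra_simps)
  also have "\<dots> = (\<Sum>i<N. \<Sum>\<pi>\<in>?P. \<Sum>l<N. (cnj (v i) * complex_of_real (amp \<pi> i)) * (v l * complex_of_real (amp \<pi> l)))"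
    by (intro sum.cong refl) (rule sum.swap)
  also have "\<dots> = (\<Sum>\<pi>\<in>?P. \<Sum>i<N. \<Sum>l<N. (cnj (v i) * complex_of_real (amp \<pi> i)) * (v l * complex_of_real (amp \<pi> l)))"
    by (rule sum.swap)
  also have "\<dots> = (\<Sum>\<pi>\<in>?P. cnj (\<Sum>i<N. v i * complex_of_real (amp \<pi> i)) * (\<Sum>i<N. v i * complex_of_real (amp \<pi> i)))"
    by (simp add: sum_product)
  also have "\<dots> = complex_of_real (\<Sum>\<pi>\<in>?P. (cmod (\<Sum>i<N. v i * complex_of_real (amp \<pi> i)))\<^sup>2)"
    unfolding of_real_sum complex_norm_square by (simp add: mult.commute)
  also have "0 \<le> \<dots>" by (simp add: less_eq_complex_def sum_nonneg)
  finally show "0 \<le> quad_form N (block j) v" .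
qed (auto simp: block_def mult.commute)

text \<open>The rank-one matrix lives on \<open>a'\<close> and \<open>b'\<close>. The exchange fixes
  its two diagonal positions, which give the cost, and sends the off-diagonal ones back to
  \<open>a\<close> and \<open>b\<close>, which gives the coupling.\<close>

lemma quad_form_block_term:
  assumes "(a, b) \<in> partners"
  defines "j \<equiv> lead (a, b)"
  defines "a' \<equiv> mix {j} a b" and "b' \<equiv> mix {j} b a"
  shows "(\<Sum>i<N. \<Sum>l<N. cnj (v (mix {j} i l)) * complex_of_real (amp (a, b) i * amp (a, b) l) * v (mix {j} l i))
    = complex_of_real ((amp (a, b) a')\<^sup>2 * (cmod (v a'))\<^sup>2 + (amp (a, b) b')\<^sup>2 * (cmod (v b'))\<^sup>2
        + 2 * weight a * Re (cnj (v a) * v b))" (is "?lhs = _")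
proof -
  have ab: "a < N" "b < N" using assms(1) by (auto simp: partners_def)
  have lt: "a' < N" "b' < N" by (simp_all add: a'_def b'_def mix_less)
  have j: "j \<in> {1..p}" "dig a j \<noteq> dig b j" using lead_partners[OF assms(1)] by (auto simp: j_def)
  have ne: "a' \<noteq> b'"
  proof
    assume "a' = b'"
    then have "dig a' j = dig b' j" by simp
    then show False using j by (simp add: a'_def b'_def dig_mix)
  qed
  have swap: "mix {j} a' b' = a" "mix {j} b' a' = b" using ab by (simp_all add: a'_def b'_def mix_mix)
  have self: "mix {j} a' a' = a'" "mix {j} b' b' = b'" using lt by (simp_all add: mix_self)
  have amp0: "amp (a, b) i = 0" if "i \<noteq> a'" "i \<noteq> b'" for i
    using that by (simp add: amp_def a'_def b'_def j_def)
  let ?F = "\<lambda>i l. cnj (v (mix {j} i l)) * complex_of_real (amp (a, b) i * amp (a, b) l) * v (mix {j} l i)"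
  have "?lhs = (\<Sum>i\<in>{a', b'}. \<Sum>l<N. ?F i l)"
    using lt amp0 by (intro sum.mono_neutral_right) auto
  also have "\<dots> = (\<Sum>i\<in>{a', b'}. \<Sum>l\<in>{a', b'}. ?F i l)"
    using lt amp0 by (intro sum.cong refl sum.mono_neutral_right) auto
  also have "\<dots> = ?F a' a' + ?F b' b' + (?F a' b' + ?F b' a')" using ne by simp
  also have "?F a' a' = complex_of_real ((amp (a, b) a')\<^sup>2 * (cmod (v a'))\<^sup>2)"
    unfolding self of_real_mult complex_norm_square by (simp add: power2_eq_square algebra_simps)
  also have "?F b' b' = complex_of_real ((amp (a, b) b')\<^sup>2 * (cmod (v b'))\<^sup>2)"
    unfolding self of_real_mult complex_norm_square by (simp add: power2_eq_square algebra_simps)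
  also have "?F a' b' + ?F b' a' = complex_of_real (amp (a, b) a' * amp (a, b) b') * (cnj (v a) * v b + cnj (cnj (v a) * v b))"
    unfolding swap by (simp add: algebra_simps)
  also have "\<dots> = complex_of_real (2 * weight a * Re (cnj (v a) * v b))"
    unfolding amp_mult[OF assms(1), folded j_def, folded a'_def b'_def] complex_add_cnj by simp
  finally show ?thesis by simp
qed

lemma sum_partners:
  "(\<Sum>j\<in>{1..p - 1}. \<Sum>\<pi>\<in>{\<pi>\<in>partners. lead \<pi> = j}. h j \<pi>) = (\<Sum>\<pi>\<in>partners. h (lead \<pi>) \<pi>)"
  for h :: "nat \<Rightarrow> nat \<times> nat \<Rightarrow> complex"
proof -
  have "(\<Sum>j\<in>{1..p - 1}. \<Sum>\<pi>\<in>{\<pi>\<in>partners. lead \<pi> = j}. h j \<pi>)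
      = (\<Sum>j\<in>{1..p - 1}. \<Sum>\<pi>\<in>{\<pi>\<in>partners. lead \<pi> = j}. h (lead \<pi>) \<pi>)"
    by (intro sum.cong refl) auto
  also have "\<dots> = (\<Sum>\<pi>\<in>partners. h (lead \<pi>) \<pi>)"
    using lead_partners(1) by (intro sum.group finite_partners) auto
  finally show ?thesis .
qed

lemma witness_negative:
  assumes nz: "\<exists>a<N. v a \<noteq> 0" and v: "\<And>s. s \<le> n \<Longrightarrow> (\<Sum>a | a < N \<and> digit_sum a = s. v a) = 0"
  shows "Re (\<Sum>j\<in>{1..p - 1}. quad_form N (partial_transpose p d {j} (block j)) v) < 0"
proof -
  \<comment> \<open>Costs and couplings are both measured against the weighted squared norm
    \<open>M\<close>.\<close>
  define G where "G = (\<lambda>i. weight i * (cmod (v i))\<^sup>2)"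
  define M where "M = (\<Sum>i<N. G i)"
  have G0: "0 \<le> G i" for i using weight_pos[of i] by (simp add: G_def)
  have GM: "G i \<le> M" if "i < N" for i
    unfolding M_def using that G0 by (intro member_le_sum) auto
  have M: "M > 0"
  proof -
    obtain a where "a < N" "v a \<noteq> 0" using nz by blast
    then have "0 < G a" using weight_pos[of a] by (simp add: G_def)
    then show ?thesis using GM[OF \<open>a < N\<close>] by simp
  qed
  let ?T = "\<lambda>j \<pi>. \<Sum>i<N. \<Sum>l<N. cnj (v (mix {j} i l)) * complex_of_real (amp \<pi> i * amp \<pi> l) * v (mix {j} l i)"
  have "quad_form N (partial_transpose p d {j} (block j)) v = (\<Sum>\<pi>\<in>{\<pi>\<in>partners. lead \<pi> = j}. ?T j \<pi>)" for j
  proof -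
    let ?P = "{\<pi>\<in>partners. lead \<pi> = j}"
    have "quad_form N (partial_transpose p d {j} (block j)) v
        = (\<Sum>i<N. \<Sum>l<N. \<Sum>\<pi>\<in>?P. cnj (v (mix {j} i l)) * complex_of_real (amp \<pi> i * amp \<pi> l) * v (mix {j} l i))"
      unfolding quad_form_partial_transpose block_def
      by (intro sum.cong refl) (simp add: sum_distrib_left sum_distrib_right)
    also have "\<dots> = (\<Sum>i<N. \<Sum>\<pi>\<in>?P. \<Sum>l<N. cnj (v (mix {j} i l)) * complex_of_real (amp \<pi> i * amp \<pi> l) * v (mix {j} l i))"
      by (intro sum.cong refl) (rule sum.swap)
    also have "\<dots> = (\<Sum>\<pi>\<in>?P. ?T j \<pi>)" by (rule sum.swap)
    finally show ?thesis .
  qed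
  then have "(\<Sum>j\<in>{1..p - 1}. quad_form N (partial_transpose p d {j} (block j)) v)
      = (\<Sum>\<pi>\<in>partners. ?T (lead \<pi>) \<pi>)"
    by (simp only: sum_partners)
  then have "Re (\<Sum>j\<in>{1..p - 1}. quad_form N (partial_transpose p d {j} (block j)) v)
      = (\<Sum>\<pi>\<in>partners. Re (?T (lead \<pi>) \<pi>))" by simp
  also have "\<dots> \<le> (\<Sum>(a, b)\<in>partners. 2 * M / \<mu>\<^sup>2 + 2 * weight a * Re (cnj (v a) * v b))"
  proof (rule sum_mono, clarify)
    fix a b assume ab: "(a, b) \<in> partners"
    let ?a = "mix {lead (a, b)} a b" and ?b = "mix {lead (a, b)} b a"
    have cost: "(amp (a, b) i)\<^sup>2 * (cmod (v i))\<^sup>2 \<le> M / \<mu>\<^sup>2" if "i < N" for i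
    proof -
      have "(amp (a, b) i)\<^sup>2 * (cmod (v i))\<^sup>2 \<le> weight i / \<mu>\<^sup>2 * (cmod (v i))\<^sup>2"
        by (intro mult_right_mono amp_square[OF ab]) auto
      also have "\<dots> = G i / \<mu>\<^sup>2" by (simp add: G_def)
      also have "\<dots> \<le> M / \<mu>\<^sup>2" using GM[OF that] by (intro divide_right_mono) auto
      finally show ?thesis .
    qed
    show "Re (?T (lead (a, b)) (a, b)) \<le> 2 * M / \<mu>\<^sup>2 + 2 * weight a * Re (cnj (v a) * v b)"
      unfolding quad_form_block_term[OF ab] Re_complex_of_real
      using cost[OF mix_less, of "{lead (a, b)}" a b] cost[OF mix_less, of "{lead (a, b)}" b a] by simp
  qed
  also have "\<dots> = card partners * (2 * M / \<mu>\<^sup>2) + (\<Sum>(a, b)\<in>partners. 2 * weight a * Re (cnj (v a) * v b))"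
    by (simp add: split_def sum.distrib)
  also have "(\<Sum>(a, b)\<in>partners. 2 * weight a * Re (cnj (v a) * v b)) = - 2 * M"
  proof -
    have P: "partners = (SIGMA a:{..<N}. {b. b < N \<and> digit_sum b = digit_sum a} - {a})"
      by (auto simp: partners_def)
    have "(\<Sum>(a, b)\<in>partners. 2 * weight a * Re (cnj (v a) * v b))
        = (\<Sum>a<N. \<Sum>b\<in>{b. b < N \<and> digit_sum b = digit_sum a} - {a}. 2 * weight a * Re (cnj (v a) * v b))"
      unfolding P by (subst sum.Sigma) auto
    also have "\<dots> = (\<Sum>a<N. 2 * weight a * Re (cnj (v a) * (\<Sum>b\<in>{b. b < N \<and> digit_sum b = digit_sum a} - {a}. v b)))"
      unfolding sum_distrib_left Re_sum ..
    also have "\<dots> = (\<Sum>a<N. - 2 * G a)"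
    proof (intro sum.cong refl)
      fix a assume a: "a \<in> {..<N}"
      have "0 = (\<Sum>b\<in>{b. b < N \<and> digit_sum b = digit_sum a}. v b)"
        using v[OF digit_sum_le] by simp
      also have "\<dots> = v a + (\<Sum>b\<in>{b. b < N \<and> digit_sum b = digit_sum a} - {a}. v b)"
        using a by (intro sum.remove) auto
      \<comment> \<open>On the chosen subspace the other entries of the same digit sum add up to
        \<open>- v a\<close>, so each index contributes \<open>- 2 * G a\<close>.\<close>
      finally have "(\<Sum>b\<in>{b. b < N \<and> digit_sum b = digit_sum a} - {a}. v b) = - v a"
        by (simp add: eq_neg_iff_add_eq_0 add.commute)
      moreover have "Re (cnj (v a) * (- v a)) = - (cmod (v a))\<^sup>2"
        by (simp add: cmod_power2 flip: power2_eq_square)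
      ultimately show "2 * weight a * Re (cnj (v a) * (\<Sum>b\<in>{b. b < N \<and> digit_sum b = digit_sum a} - {a}. v b)) = - 2 * G a"
        by (simp add: G_def)
    qed
    also have "\<dots> = - 2 * M" by (simp add: M_def sum_distrib_left)
    finally show ?thesis .
  qed
  \<comment> \<open>With \<open>\<mu> = 2 * N\<close> the at most \<open>N * N\<close> pairs cost at
    most \<open>M / 2\<close> in total, against a gain of \<open>2 * M\<close>.\<close>
  also have "card partners * (2 * M / \<mu>\<^sup>2) \<le> real (N * N) * (2 * M / \<mu>\<^sup>2)"
    using card_partners M by (intro mult_right_mono) (auto simp flip: of_nat_mult)
  also have "real (N * N) * (2 * M / \<mu>\<^sup>2) = M / 2"
    using N_pos by (simp add: \<mu>_def power2_eq_square)
  finally show ?thesis using M by linarith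
qed

text \<open>The subspace of negativity is cut out by \<open>n + 1\<close> forms, one for each
  possible digit sum from 0 to \<open>n\<close>.\<close>

theorem witness_num_neg_eigenvalues:
  "N \<le> num_neg_eigenvalues (mat_sum N (\<lambda>j. partial_transpose p d {j} (block j)) {1..p - 1}) + (n + 1)"
proof -
  let ?W = "mat_sum N (\<lambda>j. partial_transpose p d {j} (block j)) {1..p - 1}"
  have W: "?W \<in> carrier_mat N N" by (rule sum_partial_transposes(1)) (simp_all add: block_psd)
  have herm: "?W $$ (j, i) = cnj (?W $$ (i, j))" if "i < N" "j < N" for i j
    using that by (rule sum_partial_transposes(2)[rotated 2]) (simp_all add: block_psd)
  have qf: "quad_form N ?W v = (\<Sum>j\<in>{1..p - 1}. quad_form N (partial_transpose p d {j} (block j)) v)" for v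
    by (rule sum_partial_transposes(3)) (simp_all add: block_psd)
  have "N \<le> num_neg_eigenvalues ?W + card {..n}"
  proof (rule num_neg_eigenvalues_lower_bound[OF W herm])
    fix v :: "nat \<Rightarrow> complex" assume nz: "\<exists>a<N. v a \<noteq> 0"
      and v: "\<And>s. s \<in> {..n} \<Longrightarrow> (\<Sum>a<N. v a * (if digit_sum a = s then 1 else 0)) = 0"
    have "(\<Sum>a | a < N \<and> digit_sum a = s. v a) = 0" if "s \<le> n" for s
    proof -
      have "(\<Sum>a | a < N \<and> digit_sum a = s. v a) = (\<Sum>a<N. if digit_sum a = s then v a else 0)"
        by (subst sum.inter_filter[symmetric]) (auto intro!: sum.cong)
      also have "\<dots> = (\<Sum>a<N. v a * (if digit_sum a = s then 1 else 0))" by (intro sum.cong) auto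
      finally show ?thesis using v[of s] that by simp
    qed
    then show "Re (quad_form N ?W v) < 0"
      unfolding qf by (rule witness_negative[OF nz])
  qed auto
  then show ?thesis by simp
qed

end

section \<open>The bound and its sharpness\<close>

theorem mainTheorem10:
  fixes p :: nat and d :: "nat \<Rightarrow> nat" and D :: int
  assumes "p \<ge> 2"
    and "\<forall>i \<in> {1..p}. d i > 0"
    and "D = (\<Prod>i=1..p. int (d i)) - (\<Sum>i=1..p. int (d i)) + int p - 1"
  shows "(\<forall>W. decomposable p d W \<longrightarrow> int (num_neg_eigenvalues W) \<le> D) \<and>
         (\<exists>X :: nat \<Rightarrow> complex mat.
            (\<forall>j \<in> {1..p - 1}. positive_semidefinite (tensor_dim p d) (X j)) \<and>
            int (num_neg_eigenvalues
              (mat_sum (tensor_dim p d) (\<lambda>j. partial_transpose p d {j} (X j)) {1..p - 1})) = D)"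
proof -
  interpret tensor_space p d using assms(1,2) by unfold_locales auto
  \<comment> \<open>The truncated subtraction in \<open>n\<close> is exact because every
    \<open>d k\<close> is positive.\<close>
  have "int n = (\<Sum>k=1..p. int (d k) - 1)"
    unfolding of_nat_sum using d_pos by (intro sum.cong refl) (auto simp: of_nat_diff Suc_leI)
  also have "\<dots> = (\<Sum>k=1..p. int (d k)) - int p" by (simp add: sum_subtractf)
  finally have D: "D = int N - int n - 1" using assms(3) by (simp add: tensor_dim_def)
  have "int (num_neg_eigenvalues W) \<le> D" if W: "decomposable p d W" for W
  proof -
    obtain X where X: "\<And>A. A \<in> Pow {1..p} \<Longrightarrow> positive_semidefinite N (X A)"
      and W: "W = mat_sum N (\<lambda>A. partial_transpose p d A (X A)) (Pow {1..p})"
      using W by (auto simp: decomposable_def)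
    have "num_neg_eigenvalues W + n + 1 \<le> N"
      unfolding W by (rule sum_partial_transposes(4)) (use X in auto)
    then show ?thesis using D by linarith
  qed
  moreover have "int (num_neg_eigenvalues
      (mat_sum N (\<lambda>j. partial_transpose p d {j} (block j)) {1..p - 1})) = D"
  proof -
    have "num_neg_eigenvalues (mat_sum N (\<lambda>j. partial_transpose p d {j} (block j)) {1..p - 1}) + n + 1 \<le> N"
      by (rule sum_partial_transposes(4)) (simp_all add: block_psd)
    then show ?thesis using witness_num_neg_eigenvalues D by linarith
  qed
  ultimately show ?thesis by (intro conjI allI impI exI[of _ block] ballI block_psd)
qed

end
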